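(* Let $A,B,p\in\mathcal O=\mathbb Z[\omega_8]$ with $p$ prime, $\mathbb N(p)\equiv 1\pmod 4$ and $(AB,p)=1$. Then $$\sum_{x (p)}e\!\left(\frac{Ax^4+Bx^2}{p}\right)-\sum_{x(p)}e\!\left(\frac{Ax^2+Bx}{p}\right)=\sum_{x(p)}\left(\frac xp\right)_2 e\!\left(\frac{Ax^2+Bx}{p}\right),$$ with $$\sum_{x(p)}\left(\frac xp\right)_2 e\!\left(\frac{Ax^2+Bx}{p}\right)=\left(\frac{AB}{p}\right)_2 e\!\left(\frac{-B^2\,\overline{8A}}{p}\right)S_4\!\left(\overline{4^2A}\,B^2,\ \overline{4^2A}\,B^2,\ p\right).$$
   Context: $\mathbf F=\mathbb Q[\omega_8]$ with $\omega_8$ a primitive 8th root of unity, ring of integers $\mathcal O=\mathbb Z[\omega_8]$. $\delta$ is a fixed generator of the different ideal of $\mathbf F$ and $e(z)=\exp(2\pi i\,\mathrm{Tr}_{\mathbf F/\mathbb Q}(z/\delta))$. $\mathbb N$ is the absolute norm. $\sum_{x(c)}$ is a sum over residue classes of $\mathcal O/(c)$ and $\sum_{x(c)^*}$ over invertible residue classes. $\left(\frac{\cdot}{c}\right)_2$ and $\left(\frac{\cdot}{c}\right)_4$ are the quadratic and quartic power residue symbols of $\mathbf F$ (zero on classes not coprime to $c$). In an expression with denominator $c$ inside $e(\cdot)$ or as an argument of $S_4(\cdot,\cdot,c)$, $\overline{y}$ denotes the multiplicative inverse of $y$ modulo $c$. The Kloosterman sum is $S_4(a,b,c)=\sum_{x(c)^*}\left(\frac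 xc\right)_4e\!\left(\frac{ax+b\overline x}{c}\right)$. *)

theory Defs
  imports
    Complex_Main
    "HOL-Computational_Algebra.Polynomial"
    "HOL-Number_Theory.Cong"
    "HOL-Algebra.Algebraic_Closure_Type"
    "HOL-Algebra.Ring_Divisibility"
    "HOL-Algebra.QuotRing"
begin

definition omega8 :: complex where
  "omega8 = cis (2 * pi / 8)"

text \<open>
  The field \<open>F8\<close> and its ring of integers \<open>O8\<close> are realised inside the complex numbers, as
  rational and integral polynomials in \<open>omega8\<close>; the records \<open>ringF\<close> and \<open>ringO\<close> are the
  corresponding ring objects.
\<close>

definition F8 :: "complex set" where
  "F8 = range (\<lambda>f :: rat poly. poly (map_poly of_rat f) omega8)"

definition O8 :: "complex set" where
  "O8 = range (\<lambda>f :: int poly. poly (map_poly of_int f) omega8)"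

abbreviation ringC :: "complex ring" where
  "ringC \<equiv> ring_of_type_algebra"

definition ringF :: "complex ring" where
  "ringF = ringC\<lparr>carrier := F8\<rparr>"

definition ringO :: "complex ring" where
  "ringO = ringC\<lparr>carrier := O8\<rparr>"

text \<open>
  Elements of \<open>ring_hom\<close> are total functions, so field embeddings are taken extensional: otherwise
  arbitrary values outside \<open>F8\<close> would produce infinitely many functions for each embedding.
\<close>

definition embeddings :: "(complex \<Rightarrow> complex) set" where
  "embeddings = ring_hom ringF ringC \<inter> extensional F8"

definition traceF :: "complex \<Rightarrow> complex" where
  "traceF z = (\<Sum>\<sigma>\<in>embeddings. \<sigma> z)"

definition codifferent :: "complex set" where
  "codifferent = {x \<in> F8. \<forall>y\<in>O8. traceF (x * y) \<in> \<int>}"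

definition different :: "complex set" where
  "different = {x \<in> F8. \<forall>y\<in>codifferent. x * y \<in> O8}"

definition different_generator :: "complex \<Rightarrow> bool" where
  "different_generator \<delta> \<longleftrightarrow> \<delta> \<in> O8 \<and> different = PIdl\<^bsub>ringO\<^esub> \<delta>"

definition add_char :: "complex \<Rightarrow> complex \<Rightarrow> complex" where
  "add_char \<delta> z = exp (2 * complex_of_real pi * \<i> * traceF (z / \<delta>))"

abbreviation residue_ring_mod :: "complex \<Rightarrow> complex set ring" where
  "residue_ring_mod c \<equiv> ringO Quot (PIdl\<^bsub>ringO\<^esub> c)"

definition abs_norm :: "complex \<Rightarrow> nat" where
  "abs_norm c = card (carrier (residue_ring_mod c))"

text \<open>
  Residue classes are cosets, i.e. elements of the quotient ring, and the summand is evaluated at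
  a representative of each class. The sums are only meaningful for summands that are constant on
  residue classes, where the choice of representative does not matter.
\<close>

definition residue_rep :: "complex set \<Rightarrow> complex" where
  "residue_rep C = (SOME x. x \<in> C)"

definition residue_sum :: "complex \<Rightarrow> (complex \<Rightarrow> complex) \<Rightarrow> complex" where
  "residue_sum c f = (\<Sum>C\<in>carrier (residue_ring_mod c). f (residue_rep C))"

definition unit_residue_sum :: "complex \<Rightarrow> (complex \<Rightarrow> complex) \<Rightarrow> complex" where
  "unit_residue_sum c f = (\<Sum>C\<in>Units (residue_ring_mod c). f (residue_rep C))"

definition inv_mod :: "complex \<Rightarrow> complex \<Rightarrow> complex" where
  "inv_mod c y = (SOME z. z \<in> O8 \<and> y * z - 1 \<in> PIdl\<^bsub>ringO\<^esub> c)"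

text \<open>
  The \<open>n\<close>-th power residue symbol at a prime element \<open>q\<close>, for \<open>n\<close> dividing 8 and \<open>q\<close> not dividing
  2: the unique \<open>n\<close>-th root of unity congruent to \<open>x\<close> raised to the power \<open>(N(q) - 1) / n\<close>.
\<close>

definition prime_residue_symbol :: "nat \<Rightarrow> complex \<Rightarrow> complex \<Rightarrow> complex" where
  "prime_residue_symbol n x q =
     (if x \<in> PIdl\<^bsub>ringO\<^esub> q then 0
      else (THE \<zeta>. \<zeta> \<in> O8 \<and> \<zeta> ^ n = 1 \<and>
              x ^ ((abs_norm q - 1) div n) - \<zeta> \<in> PIdl\<^bsub>ringO\<^esub> q))"

text \<open>
  Multiplicative extension to general moduli \<open>c\<close> coprime to 2 (empty product for units). Since \<open>O8\<close>
  is a principal ideal domain, irreducible elements are prime and \<open>c\<close> has a factorisation which is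
  unique up to order and units, neither of which affects the value.
\<close>

definition residue_symbol :: "nat \<Rightarrow> complex \<Rightarrow> complex \<Rightarrow> complex" where
  "residue_symbol n x c =
     prod_list (map (prime_residue_symbol n x)
       (SOME qs. set qs \<subseteq> O8 \<and> wfactors ringO qs c))"

definition kloosterman4 :: "complex \<Rightarrow> complex \<Rightarrow> complex \<Rightarrow> complex \<Rightarrow> complex" where
  "kloosterman4 \<delta> a b c =
     unit_residue_sum c
       (\<lambda>x. residue_symbol 4 x c * add_char \<delta> ((a * x + b * inv_mod c x) / c))"

end

theory Submission
  imports Defs
begin

text \<open>
  Write \<open>k\<close> for the residue field of \<open>p\<close>, put \<open>\<psi>(x) = e(x/p)\<close>, and let \<open>\<chi>\<^sub>2\<close> and \<open>\<chi>\<^sub>4\<close> be the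
  quadratic and the quartic symbol modulo \<open>p\<close>.

  Since \<open>x\<^sup>2 = u\<close> has \<open>1 + \<chi>\<^sub>2(u)\<close> solutions in \<open>k\<close> (\<open>card_square_roots\<close>), the sum of \<open>F(x\<^sup>2)\<close> over \<open>k\<close>
  is the sum of \<open>(1 + \<chi>\<^sub>2(u)) F(u)\<close> (\<open>sum_squares\<close>). The first identity is the case
  \<open>F(u) = \<psi>(A u\<^sup>2 + B u)\<close>.

  For the second identity put \<open>a = B\<^sup>2/(16 A)\<close>. Substituting \<open>x = B s / A\<close> on the left gives
  \<open>\<chi>\<^sub>2(A B)\<close> times the sum of \<open>\<chi>\<^sub>2(s) \<psi>(16 a (s\<^sup>2 + s))\<close>, while multiplying the Kloosterman sum on the
  right by \<open>e(-B\<^sup>2/(8 A p)) = \<psi>(-2 a)\<close> gives the sum of \<open>\<chi>\<^sub>4(x) \<psi>(a (x + 1/x - 2))\<close>. These two sums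
  agree with an arbitrary function \<open>F\<close> on \<open>k\<close> in place of \<open>z \<mapsto> \<psi>(a z)\<close>
  (\<open>quartic_sum_eq_quadratic_sum\<close>): both are one half of the sum \<open>T\<close> of \<open>\<chi>\<^sub>2(y) F((y - 1/y)\<^sup>2)\<close>
  over \<open>y \<noteq> 0\<close>.

  \<^item> In the quartic sum (\<open>quartic_sum\<close>) the non-squares cancel: there \<open>\<chi>\<^sub>4(x) = \<plusminus>\<i>\<close>, so \<open>x\<close> and \<open>1/x\<close>
    contribute with opposite signs, whereas \<open>x + 1/x\<close> is the same for both. A square \<open>x = y\<^sup>2\<close> has
    \<open>\<chi>\<^sub>4(x) = \<chi>\<^sub>2(y)\<close> and two roots with equal \<open>\<chi>\<^sub>2\<close>, because \<open>-1\<close> is a square in \<open>k\<close>; and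
    \<open>y\<^sup>2 + 1/y\<^sup>2 - 2 = (y - 1/y)\<^sup>2\<close>.
  \<^item> For the quadratic sum (\<open>quadratic_twist_sum\<close>) collect in \<open>T\<close> the \<open>y\<close> with the same
    \<open>s = (y - 1)\<^sup>2/(4 y)\<close>. Then \<open>16 (s\<^sup>2 + s) = (y - 1/y)\<^sup>2\<close>, and \<open>\<chi>\<^sub>2(y) = \<chi>\<^sub>2(s)\<close> unless \<open>s = 0\<close>.
    The equation for \<open>y\<close> is quadratic with discriminant \<open>16 (s\<^sup>2 + s)\<close>, so \<open>s\<close> arises from
    \<open>1 + \<chi>\<^sub>2(s\<^sup>2 + s)\<close> values of \<open>y\<close> and contributes \<open>\<chi>\<^sub>2(s) + \<chi>\<^sub>2(s + 1)\<close> times \<open>F(16 (s\<^sup>2 + s))\<close>.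
    The substitution \<open>s \<mapsto> -1 - s\<close> fixes \<open>s\<^sup>2 + s\<close> and exchanges the two terms.

  That \<open>\<psi>\<close> is well defined on \<open>k\<close> requires \<open>Tr(y/\<delta>)\<close> to be an integer for integral \<open>y\<close>. As
  \<open>Tr(\<omega>\<^sub>8\<^sup>j)\<close> is \<open>4\<close> for \<open>j = 0\<close> and \<open>0\<close> for \<open>j = 1, 2, 3\<close> (\<open>traceF_cubic\<close>), the different contains \<open>4\<close>,
  hence \<open>\<delta>\<close> divides \<open>4\<close>, and the trace takes integral values on \<open>O8 / 4\<close>.

  Computations in \<open>k\<close> are carried out with elements of \<open>O8\<close> up to a congruence \<open>\<approx>\<close>, so that
  polynomial identities are identities between complex numbers; sums over residue classes become
  sums over a set \<open>R\<close> of representatives, and substitutions are justified by \<open>sum_reindex\<close>.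
\<close>

section \<open>The ring \<open>\<int>[\<omega>\<^sub>8]\<close> and the field \<open>\<rat>[\<omega>\<^sub>8]\<close>\<close>

definition cubic :: "complex \<Rightarrow> complex \<Rightarrow> complex \<Rightarrow> complex \<Rightarrow> complex \<Rightarrow> complex" where
  "cubic x a b c d = a + b * x + c * x ^ 2 + d * x ^ 3"

lemma cubic_add: "cubic x a b c d + cubic x a' b' c' d' = cubic x (a + a') (b + b') (c + c') (d + d')"
  by (simp add: cubic_def algebra_simps)

lemma cubic_cong: "a = a' \<Longrightarrow> b = b' \<Longrightarrow> c = c' \<Longrightarrow> d = d' \<Longrightarrow> cubic x a b c d = cubic x a' b' c' d'"
  by simp

text \<open>
  With \<open>x ^ 4 = -1\<close> the cubic expressions multiply as in \<open>\<int>[X]/(X^4 + 1)\<close>. The lemma is needed for all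
  four roots at once, since the embeddings send \<open>omega8\<close> to each of them.
\<close>

lemma cubic_mult:
  assumes "x ^ 4 = -1"
  shows "cubic x a b c d * cubic x a' b' c' d' =
    cubic x (a * a' - b * d' - c * c' - d * b') (a * b' + b * a' - c * d' - d * c')
      (a * c' + b * b' + c * a' - d * d') (a * d' + b * c' + c * b' + d * a')"
    (is "?l = ?r")
proof -
  \<comment> \<open>quotient of the plain product by \<open>x ^ 4 + 1\<close>\<close>
  have "?l - ?r = (x ^ 4 + 1) * (b * d' + c * c' + d * b' + (c * d' + d * c') * x + d * d' * x ^ 2)"
    by (simp add: cubic_def algebra_simps power2_eq_square power3_eq_cube power4_eq_xxxx)
  then show ?thesis by (simp add: assms)
qed

lemma cubic_shift:
  assumes "x ^ 4 = -1"
  shows "n + x * cubic x a b c d = cubic x (n - d) a b c" (is "?l = ?r")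
proof -
  have "?l - ?r = (x ^ 4 + 1) * d"
    by (simp add: cubic_def algebra_simps power2_eq_square power3_eq_cube power4_eq_xxxx)
  then show ?thesis by (simp add: assms)
qed

lemma omega8_square: "omega8 ^ 2 = \<i>"
proof -
  have "omega8 ^ 2 = cis (2 * (2 * pi / 8))"
    unfolding omega8_def by (simp add: Complex.DeMoivre)
  also have "2 * (2 * pi / 8) = pi / 2" by simp
  finally show ?thesis by simp
qed

lemma omega8_pow4: "omega8 ^ 4 = -1"
proof -
  have "omega8 ^ 4 = (omega8 ^ 2) ^ 2" by (simp flip: power_mult)
  then show ?thesis by (simp add: omega8_square)
qed

lemma omega8_eq: "omega8 = Complex (1 / sqrt 2) (1 / sqrt 2)"
proof -
  have "2 * pi / 8 = pi / 4" by simp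
  then show ?thesis
    by (simp add: omega8_def complex_eq_iff cos_45 sin_45 real_div_sqrt field_simps)
qed

definition omega8_span :: "complex set \<Rightarrow> complex set" where
  "omega8_span S = {cubic omega8 a b c d | a b c d. a \<in> S \<and> b \<in> S \<and> c \<in> S \<and> d \<in> S}"

lemma omega8_spanI:
  "a \<in> S \<Longrightarrow> b \<in> S \<Longrightarrow> c \<in> S \<Longrightarrow> d \<in> S \<Longrightarrow> cubic omega8 a b c d \<in> omega8_span S"
  by (auto simp: omega8_span_def)

lemma omega8_spanE:
  assumes "x \<in> omega8_span S"
  obtains a b c d where "a \<in> S" "b \<in> S" "c \<in> S" "d \<in> S" "x = cubic omega8 a b c d"
  using assms by (auto simp: omega8_span_def)

lemma omega8_span_add:
  assumes "x \<in> omega8_span S" "y \<in> omega8_span S"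
    and "\<And>a b. a \<in> S \<Longrightarrow> b \<in> S \<Longrightarrow> a + b \<in> S"
  shows "x + y \<in> omega8_span S"
proof -
  obtain a b c d a' b' c' d' where
    "a \<in> S" "b \<in> S" "c \<in> S" "d \<in> S" "a' \<in> S" "b' \<in> S" "c' \<in> S" "d' \<in> S"
    and xy: "x = cubic omega8 a b c d" "y = cubic omega8 a' b' c' d'"
    using assms(1,2) by (elim omega8_spanE)
  then show ?thesis unfolding xy cubic_add by (intro omega8_spanI assms(3))
qed

lemma omega8_span_mult:
  assumes "x \<in> omega8_span S" "y \<in> omega8_span S"
    and "\<And>a b. a \<in> S \<Longrightarrow> b \<in> S \<Longrightarrow> a + b \<in> S" "\<And>a b. a \<in> S \<Longrightarrow> b \<in> S \<Longrightarrow> a - b \<in> S"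
    and "\<And>a b. a \<in> S \<Longrightarrow> b \<in> S \<Longrightarrow> a * b \<in> S"
  shows "x * y \<in> omega8_span S"
proof -
  obtain a b c d a' b' c' d' where
    "a \<in> S" "b \<in> S" "c \<in> S" "d \<in> S" "a' \<in> S" "b' \<in> S" "c' \<in> S" "d' \<in> S"
    and xy: "x = cubic omega8 a b c d" "y = cubic omega8 a' b' c' d'"
    using assms(1,2) by (elim omega8_spanE)
  then show ?thesis unfolding xy cubic_mult[OF omega8_pow4]
    by (intro omega8_spanI assms(3-5))
qed

lemma O8_eq_span: "O8 = omega8_span \<int>"
proof
  have "poly (map_poly of_int f) omega8 \<in> omega8_span \<int>" for f :: "int poly"
  proof (induction f)
    case 0
    have "cubic omega8 0 0 0 0 \<in> omega8_span \<int>" by (intro omega8_spanI) auto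
    then show ?case by (simp add: cubic_def)
  next
    case (pCons n f)
    then obtain a b c d where abcd: "a \<in> \<int>" "b \<in> \<int>" "c \<in> \<int>" "d \<in> \<int>"
        "poly (map_poly of_int f) omega8 = cubic omega8 a b c d"
      by (auto simp: omega8_span_def)
    have "poly (map_poly of_int (pCons n f)) omega8 = of_int n + omega8 * cubic omega8 a b c d"
      by (simp add: map_poly_pCons abcd(5))
    also have "\<dots> = cubic omega8 (of_int n - d) a b c"
      by (rule cubic_shift[OF omega8_pow4])
    finally show ?case using abcd by (auto intro!: omega8_spanI)
  qed
  then show "O8 \<subseteq> omega8_span \<int>" by (auto simp: O8_def)
next
  show "omega8_span \<int> \<subseteq> O8"
  proof
    fix z assume "z \<in> omega8_span \<int>"
    then obtain a b c d :: int where
      "z = cubic omega8 (of_int a) (of_int b) (of_int c) (of_int d)"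
      by (auto simp: omega8_span_def elim!: Ints_cases)
    then have "z = poly (map_poly of_int [:a, b, c, d:]) omega8"
      by (simp add: map_poly_pCons cubic_def algebra_simps power2_eq_square power3_eq_cube)
    then show "z \<in> O8" unfolding O8_def by blast
  qed
qed

lemma F8_eq_span: "F8 = omega8_span \<rat>"
proof
  have "poly (map_poly of_rat f) omega8 \<in> omega8_span \<rat>" for f :: "rat poly"
  proof (induction f)
    case 0
    have "cubic omega8 0 0 0 0 \<in> omega8_span \<rat>" by (intro omega8_spanI) auto
    then show ?case by (simp add: cubic_def)
  next
    case (pCons n f)
    then obtain a b c d where abcd: "a \<in> \<rat>" "b \<in> \<rat>" "c \<in> \<rat>" "d \<in> \<rat>"
        "poly (map_poly of_rat f) omega8 = cubic omega8 a b c d"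
      by (auto simp: omega8_span_def)
    have "poly (map_poly of_rat (pCons n f)) omega8 = of_rat n + omega8 * cubic omega8 a b c d"
      by (simp add: map_poly_pCons abcd(5))
    also have "\<dots> = cubic omega8 (of_rat n - d) a b c"
      by (rule cubic_shift[OF omega8_pow4])
    finally show ?case using abcd by (auto intro!: omega8_spanI)
  qed
  then show "F8 \<subseteq> omega8_span \<rat>" by (auto simp: F8_def)
next
  show "omega8_span \<rat> \<subseteq> F8"
  proof
    fix z assume "z \<in> omega8_span \<rat>"
    then obtain a b c d :: rat where
      "z = cubic omega8 (of_rat a) (of_rat b) (of_rat c) (of_rat d)"
      by (auto simp: omega8_span_def elim!: Rats_cases)
    then have "z = poly (map_poly of_rat [:a, b, c, d:]) omega8"
      by (simp add: map_poly_pCons cubic_def algebra_simps power2_eq_square power3_eq_cube)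
    then show "z \<in> F8" unfolding F8_def by blast
  qed
qed

lemma O8_Int: "n \<in> \<int> \<Longrightarrow> n \<in> O8"
  using omega8_spanI[of n \<int> 0 0 0] by (simp add: O8_eq_span cubic_def)

lemma O8_closed [simp, intro]:
  shows O8_0: "0 \<in> O8" and O8_1: "1 \<in> O8" and O8_numeral: "numeral k \<in> O8" and O8_ii: "\<i> \<in> O8"
    and O8_add: "x \<in> O8 \<Longrightarrow> y \<in> O8 \<Longrightarrow> x + y \<in> O8"
    and O8_uminus: "x \<in> O8 \<Longrightarrow> - x \<in> O8"
    and O8_diff: "x \<in> O8 \<Longrightarrow> y \<in> O8 \<Longrightarrow> x - y \<in> O8"
    and O8_mult: "x \<in> O8 \<Longrightarrow> y \<in> O8 \<Longrightarrow> x * y \<in> O8"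
    and O8_power: "x \<in> O8 \<Longrightarrow> x ^ n \<in> O8"
proof -
  show one: "0 \<in> O8" "1 \<in> O8" "numeral k \<in> O8" by (auto intro: O8_Int)
  show "\<i> \<in> O8"
    using omega8_spanI[of 0 \<int> 0 1 0] by (simp add: O8_eq_span cubic_def omega8_square)
  show add: "x + y \<in> O8" if "x \<in> O8" "y \<in> O8" for x y
    using that unfolding O8_eq_span by (rule omega8_span_add) (rule Ints_add)
  show mult: "x * y \<in> O8" if "x \<in> O8" "y \<in> O8" for x y
    using that unfolding O8_eq_span by (rule omega8_span_mult) auto
  show uminus: "- x \<in> O8" if "x \<in> O8" for x
    using mult[OF O8_Int[of "-1"] that] by simp
  show "x - y \<in> O8" if "x \<in> O8" "y \<in> O8" for x y
    using add[OF that(1) uminus[OF that(2)]] by simp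
  show "x ^ n \<in> O8" if "x \<in> O8" for x
    using that by (induction n) (auto intro: mult one)
qed

lemma O8_subset_F8: "O8 \<subseteq> F8"
proof -
  have "\<int> \<subseteq> (\<rat> :: complex set)" by (auto elim!: Ints_cases)
  then show ?thesis unfolding O8_eq_span F8_eq_span omega8_span_def by blast
qed

lemma F8_add: "x \<in> F8 \<Longrightarrow> y \<in> F8 \<Longrightarrow> x + y \<in> F8"
  unfolding F8_eq_span by (rule omega8_span_add) auto

lemma F8_mult: "x \<in> F8 \<Longrightarrow> y \<in> F8 \<Longrightarrow> x * y \<in> F8"
  unfolding F8_eq_span by (rule omega8_span_mult) auto

lemma F8_Rat: "r \<in> \<rat> \<Longrightarrow> r \<in> F8"
  using omega8_spanI[of r \<rat> 0 0 0] by (simp add: F8_eq_span cubic_def)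

lemma sqrt2_irrational: "sqrt 2 \<notin> \<rat>"
proof
  assume "sqrt 2 \<in> \<rat>"
  then obtain m n :: nat where n: "n \<noteq> 0" and eq: "\<bar>sqrt 2\<bar> = real m / real n" and "coprime m n"
    by (rule Rats_abs_nat_div_natE)
  have "real (m ^ 2) = real (2 * n ^ 2)"
    using arg_cong[OF eq, of "\<lambda>x. x ^ 2"] n by (simp add: power_divide field_simps)
  then have *: "m ^ 2 = 2 * n ^ 2" by linarith
  then have "even m" by (metis dvd_triv_left even_power)
  then obtain k where "m = 2 * k" by blast
  then have "n ^ 2 = 2 * k ^ 2" using * by (simp add: power_mult_distrib)
  then have "even n" by (metis dvd_triv_left even_power)
  then show False using \<open>even m\<close> \<open>coprime m n\<close> by (metis coprime_common_divisor odd_one)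
qed

lemma rat_sqrt2_eq_0:
  assumes "x \<in> \<rat>" "y \<in> \<rat>" "x + y / sqrt 2 = 0"
  shows "x = 0 \<and> y = 0"
proof -
  have eq: "x * sqrt 2 = - y"
  proof -
    have "x * sqrt 2 + y = (x + y / sqrt 2) * sqrt 2" by (simp add: distrib_right)
    then show ?thesis using assms(3) by simp
  qed
  have "x = 0"
  proof (rule ccontr)
    assume x: "x \<noteq> 0"
    have "sqrt 2 = (x * sqrt 2) / x" using x by simp
    also have "\<dots> \<in> \<rat>" unfolding eq using assms(1,2) by (intro Rats_divide) auto
    finally show False using sqrt2_irrational by simp
  qed
  then show ?thesis using eq by simp
qed

text \<open>
  Real and imaginary part of the expression have the form \<open>r + s / sqrt 2\<close> with rational \<open>r\<close> and \<open>s\<close>,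
  so irrationality of \<open>sqrt 2\<close> replaces the irreducibility of \<open>X^4 + 1\<close>.
\<close>

lemma cubic_omega8_eq_0:
  assumes "a \<in> \<rat>" "b \<in> \<rat>" "c \<in> \<rat>" "d \<in> \<rat>" "cubic omega8 a b c d = 0"
  shows "a = 0 \<and> b = 0 \<and> c = 0 \<and> d = 0"
proof -
  have "\<exists>x'\<in>\<rat>. x = complex_of_real x'" if x: "x \<in> \<rat>" for x
  proof -
    obtain m n where "x = of_int m / of_int n"
      using x by (auto elim!: Rats_cases')
    then have "x = complex_of_real (of_int m / of_int n)" by simp
    then show ?thesis by (intro bexI[of _ "of_int m / of_int n"]) auto
  qed
  then obtain a' b' c' d' where R: "a' \<in> \<rat>" "b' \<in> \<rat>" "c' \<in> \<rat>" "d' \<in> \<rat>"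
    and eq: "a = complex_of_real a'" "b = complex_of_real b'" "c = complex_of_real c'"
      "d = complex_of_real d'"
    using assms(1-4) by metis
  have "omega8 ^ 3 = \<i> * omega8"
    by (simp add: power3_eq_cube omega8_square[symmetric] power2_eq_square)
  then have z: "of_real a' + of_real b' * omega8 + of_real c' * \<i>
      + of_real d' * (\<i> * omega8) = 0"
    using assms(5) by (simp add: cubic_def eq omega8_square)
  have "a' + (b' - d') / sqrt 2 = 0"
    using arg_cong[OF z, of Re] by (simp add: omega8_eq field_simps)
  then have 1: "a' = (0::real)" "b' - d' = (0::real)"
    using rat_sqrt2_eq_0[of "a'" "b' - d'"] R by auto
  have "c' + (b' + d') / sqrt 2 = 0"
    using arg_cong[OF z, of Im] by (simp add: omega8_eq field_simps)
  then have 2: "c' = (0::real)" "b' + d' = (0::real)"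
    using rat_sqrt2_eq_0[of "c'" "b' + d'"] R by auto
  have "b' = (0::real)" "d' = (0::real)" using 1(2) 2(2) by linarith+
  then show ?thesis using 1 2 by (simp add: eq)
qed

lemma cubic_omega8_inj:
  assumes "a \<in> \<rat>" "b \<in> \<rat>" "c \<in> \<rat>" "d \<in> \<rat>" "a' \<in> \<rat>" "b' \<in> \<rat>" "c' \<in> \<rat>" "d' \<in> \<rat>"
    and "cubic omega8 a b c d = cubic omega8 a' b' c' d'"
  shows "a = a' \<and> b = b' \<and> c = c' \<and> d = d'"
proof -
  have "cubic omega8 (a - a') (b - b') (c - c') (d - d') = 0"
    using assms(9) by (simp add: cubic_def algebra_simps)
  then show ?thesis using cubic_omega8_eq_0[of "a - a'" "b - b'" "c - c'" "d - d'"] assms by auto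
qed

text \<open>
  The norm to \<open>\<rat>\<close> is formed in two steps: \<open>z'\<close> below is the conjugate under \<open>omega8 \<mapsto> - omega8\<close>, so
  \<open>z * z' = r + s \<i>\<close> with rational \<open>r\<close> and \<open>s\<close>, which is then multiplied by \<open>r - s \<i>\<close>.
\<close>

lemma F8_inverse:
  assumes "z \<in> F8"
  shows "inverse z \<in> F8"
proof (cases "z = 0")
  case False
  obtain a b c d where abcd: "a \<in> \<rat>" "b \<in> \<rat>" "c \<in> \<rat>" "d \<in> \<rat>" and z: "z = cubic omega8 a b c d"
    using assms by (auto simp: F8_eq_span omega8_span_def)
  define z' where "z' = cubic omega8 a (- b) c (- d)"
  define r s where "r = a * a - c * c + 2 * b * d" and "s = 2 * a * c - b * b + d * d"
  have rs: "r \<in> \<rat>" "s \<in> \<rat>" using abcd by (auto simp: r_def s_def)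
  have zz: "z * z' = cubic omega8 r 0 s 0"
    unfolding z z'_def cubic_mult[OF omega8_pow4]
    by (rule cubic_cong) (simp_all add: r_def s_def algebra_simps)
  have w: "cubic omega8 r 0 s 0 * cubic omega8 r 0 (- s) 0 = r * r + s * s"
    by (simp add: cubic_mult[OF omega8_pow4]) (simp add: cubic_def)
  have z'0: "z' \<noteq> 0"
  proof
    assume "z' = 0"
    then have "a = 0 \<and> - b = 0 \<and> c = 0 \<and> - d = 0"
      using abcd unfolding z'_def by (intro cubic_omega8_eq_0) auto
    then show False using False z by (simp add: cubic_def)
  qed
  have "cubic omega8 r 0 s 0 \<noteq> 0" using False z'0 zz by (metis mult_eq_0_iff)
  moreover have "cubic omega8 r 0 (- s) 0 \<noteq> 0"
  proof
    assume "cubic omega8 r 0 (- s) 0 = 0"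
    then have "r = 0 \<and> - s = 0"
      using rs cubic_omega8_eq_0[of r 0 "- s" 0] by auto
    then show False using calculation by (simp add: cubic_def)
  qed
  ultimately have n: "r * r + s * s \<noteq> 0" using w by (metis mult_eq_0_iff)
  have "z * (z' * cubic omega8 r 0 (- s) 0 * inverse (r * r + s * s)) = 1"
    using w n by (simp add: mult.assoc[symmetric] zz)
  then have "inverse z = z' * cubic omega8 r 0 (- s) 0 * inverse (r * r + s * s)"
    by (rule inverse_unique)
  moreover have "z' \<in> F8" "cubic omega8 r 0 (- s) 0 \<in> F8"
    using abcd rs by (auto simp: z'_def F8_eq_span intro!: omega8_spanI)
  moreover have "inverse (r * r + s * s) \<in> F8" using rs by (intro F8_Rat) auto
  ultimately show ?thesis by (simp add: F8_mult)
qed (use O8_subset_F8 in auto)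

lemma F8_divide: "x \<in> F8 \<Longrightarrow> y \<in> F8 \<Longrightarrow> x / y \<in> F8"
  by (simp add: divide_inverse F8_mult F8_inverse)

section \<open>Trace, different and the additive character\<close>

lemma ring_of_type_algebra_simps [simp]:
  "carrier ringC = UNIV" "mult ringC = (*)" "one ringC = 1" "zero ringC = 0" "add ringC = (+)"
  by (simp_all add: ring_of_type_algebra_def)

lemma ringF_simps [simp]:
  "carrier ringF = F8" "mult ringF = (*)" "one ringF = 1" "zero ringF = 0" "add ringF = (+)"
  by (simp_all add: ringF_def)

lemma ringO_simps [simp]:
  "carrier ringO = O8" "mult ringO = (*)" "one ringO = 1" "zero ringO = 0" "add ringO = (+)"
  by (simp_all add: ringO_def)

lemma embedding_cubic:
  assumes "\<sigma> \<in> embeddings" "a \<in> \<rat>" "b \<in> \<rat>" "c \<in> \<rat>" "d \<in> \<rat>"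
  shows "\<sigma> (cubic omega8 a b c d) = cubic (\<sigma> omega8) a b c d"
proof -
  have hom: "\<sigma> (x + y) = \<sigma> x + \<sigma> y" "\<sigma> (x * y) = \<sigma> x * \<sigma> y" if "x \<in> F8" "y \<in> F8" for x y
    using assms(1) that by (auto simp: embeddings_def ring_hom_def)
  have hom1: "\<sigma> 1 = 1"
    using assms(1) by (auto simp: embeddings_def ring_hom_def)
  have w: "omega8 \<in> F8"
    using omega8_spanI[of 0 \<rat> 1 0 0] by (simp add: F8_eq_span cubic_def)
  have nat: "\<sigma> (of_nat n) = of_nat n" for n
  proof (induction n)
    case 0
    show ?case using hom(1)[of 0 0] O8_subset_F8 by auto
  next
    case (Suc n)
    then show ?case using hom(1)[of 1 "of_nat n"] hom1 by (simp add: F8_Rat)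
  qed
  have int: "\<sigma> (of_int n) = of_int n" for n
  proof (cases n)
    case (neg m)
    have "\<sigma> (of_int n) + \<sigma> (of_nat (Suc m)) = \<sigma> (of_int n + of_nat (Suc m))"
      by (subst hom(1)) (auto intro!: F8_Rat simp del: of_nat_Suc)
    also have "\<dots> = 0" using nat[of 0] by (simp add: neg)
    finally have "\<sigma> (of_int n) = - of_nat (Suc m)" unfolding nat by (simp only: eq_neg_iff_add_eq_0)
    then show ?thesis by (simp add: neg)
  qed (simp add: nat)
  have rat: "\<sigma> x = x" if x: "x \<in> \<rat>" for x
  proof -
    obtain m n where mn: "n > 0" "coprime m n" "x = of_int m / of_int n"
      using x by (rule Rats_cases')
    have "\<sigma> x * \<sigma> (of_int n) = \<sigma> (of_int m)"
      using that mn by (subst hom(2)[symmetric]) (auto intro!: F8_Rat)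
    then have "\<sigma> x = of_int m / of_int n" using mn(1) by (simp add: int eq_divide_eq)
    then show ?thesis by (simp only: mn(3))
  qed
  have pow: "\<sigma> (omega8 ^ n) = \<sigma> omega8 ^ n \<and> omega8 ^ n \<in> F8" for n
    by (induction n) (simp_all add: hom hom1 w F8_mult F8_Rat)
  then have F: "omega8 ^ n \<in> F8" and P: "\<sigma> (omega8 ^ n) = \<sigma> omega8 ^ n" for n by auto
  note R = F8_Rat[OF assms(2)] F8_Rat[OF assms(3)] F8_Rat[OF assms(4)] F8_Rat[OF assms(5)]
  show ?thesis unfolding cubic_def
    by (simp only: hom F8_mult F8_add R F w P rat[OF assms(2)] rat[OF assms(3)]
        rat[OF assms(4)] rat[OF assms(5)])
qed

text \<open>
  An embedding is determined by the image of \<open>omega8\<close>, as it fixes the rationals. Conversely, sending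
  \<open>omega8\<close> to any root of \<open>X^4 + 1\<close> is well defined because coordinates are unique, and multiplicative
  because \<open>cubic_mult\<close> holds for every such root.
\<close>

lemma bij_betw_embeddings: "bij_betw (\<lambda>\<sigma>. \<sigma> omega8) embeddings {\<zeta>. \<zeta> ^ 4 = -1}"
  unfolding bij_betw_def
proof
  show "inj_on (\<lambda>\<sigma>. \<sigma> omega8) embeddings"
  proof (rule inj_onI)
    fix \<sigma> \<tau> assume st: "\<sigma> \<in> embeddings" "\<tau> \<in> embeddings" and eq: "\<sigma> omega8 = \<tau> omega8"
    show "\<sigma> = \<tau>"
    proof (rule extensionalityI)
      show "\<sigma> \<in> extensional F8" "\<tau> \<in> extensional F8" using st by (auto simp: embeddings_def)
      show "\<sigma> x = \<tau> x" if "x \<in> F8" for x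
        using that eq embedding_cubic[OF st(1)] embedding_cubic[OF st(2)]
        by (auto simp: F8_eq_span omega8_span_def)
    qed
  qed
next
  show "(\<lambda>\<sigma>. \<sigma> omega8) ` embeddings = {\<zeta>. \<zeta> ^ 4 = -1}"
  proof (intro subset_antisym subsetI)
    fix \<zeta> assume "\<zeta> \<in> (\<lambda>\<sigma>. \<sigma> omega8) ` embeddings"
    then obtain \<sigma> where s: "\<sigma> \<in> embeddings" "\<zeta> = \<sigma> omega8" by auto
    have 1: "\<sigma> omega8 ^ 2 = \<sigma> (omega8 ^ 2)"
      using embedding_cubic[OF s(1), of 0 0 1 0] by (simp add: cubic_def)
    have w: "omega8 ^ 2 \<in> F8"
      using omega8_spanI[of 0 \<rat> 0 1 0] by (simp add: F8_eq_span cubic_def)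
    have "\<sigma> (x * y) = \<sigma> x * \<sigma> y" if "x \<in> F8" "y \<in> F8" for x y
      using s(1) that by (auto simp: embeddings_def ring_hom_def)
    then have 2: "\<sigma> (omega8 ^ 2) * \<sigma> (omega8 ^ 2) = \<sigma> (omega8 ^ 2 * omega8 ^ 2)" using w by metis
    have "\<zeta> ^ 4 = (\<sigma> omega8 ^ 2) * (\<sigma> omega8 ^ 2)"
      by (simp add: s(2) power2_eq_square power4_eq_xxxx mult.assoc)
    also have "\<dots> = \<sigma> (omega8 ^ 2 * omega8 ^ 2)" by (simp only: 1 2)
    also have "omega8 ^ 2 * omega8 ^ 2 = -1" by (simp add: omega8_square)
    also have "\<sigma> (-1) = -1"
      using embedding_cubic[OF s(1), of "-1" 0 0 0] by (simp add: cubic_def)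
    finally show "\<zeta> \<in> {\<zeta>. \<zeta> ^ 4 = -1}" by simp
  next
    fix \<zeta> :: complex assume "\<zeta> \<in> {\<zeta>. \<zeta> ^ 4 = -1}"
    then have \<zeta>: "\<zeta> ^ 4 = -1" by simp
    define \<sigma> where "\<sigma> = restrict (\<lambda>z. THE w. \<exists>a\<in>\<rat>. \<exists>b\<in>\<rat>. \<exists>c\<in>\<rat>. \<exists>d\<in>\<rat>.
        z = cubic omega8 a b c d \<and> w = cubic \<zeta> a b c d) F8"
    have \<sigma>: "\<sigma> (cubic omega8 a b c d) = cubic \<zeta> a b c d"
      if "a \<in> \<rat>" "b \<in> \<rat>" "c \<in> \<rat>" "d \<in> \<rat>" for a b c d
    proof -
      have "cubic omega8 a b c d \<in> F8" using that by (simp add: F8_eq_span omega8_spanI)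
      moreover have "(THE w. \<exists>a'\<in>\<rat>. \<exists>b'\<in>\<rat>. \<exists>c'\<in>\<rat>. \<exists>d'\<in>\<rat>.
          cubic omega8 a b c d = cubic omega8 a' b' c' d' \<and> w = cubic \<zeta> a' b' c' d') = cubic \<zeta> a b c d"
      proof (rule the_equality)
        fix w assume "\<exists>a'\<in>\<rat>. \<exists>b'\<in>\<rat>. \<exists>c'\<in>\<rat>. \<exists>d'\<in>\<rat>.
          cubic omega8 a b c d = cubic omega8 a' b' c' d' \<and> w = cubic \<zeta> a' b' c' d'"
        then obtain a' b' c' d' where *: "a' \<in> \<rat>" "b' \<in> \<rat>" "c' \<in> \<rat>" "d' \<in> \<rat>"
          "cubic omega8 a b c d = cubic omega8 a' b' c' d'" "w = cubic \<zeta> a' b' c' d'" by blast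
        show "w = cubic \<zeta> a b c d" using cubic_omega8_inj[OF that *(1-5)] *(6) by simp
      qed (use that in blast)
      ultimately show ?thesis by (simp add: \<sigma>_def)
    qed
    have "\<sigma> \<in> ring_hom ringF ringC"
    proof (rule ring_hom_memI)
      fix x y assume "x \<in> carrier ringF" "y \<in> carrier ringF"
      then have "x \<in> omega8_span \<rat>" "y \<in> omega8_span \<rat>" by (simp_all add: F8_eq_span)
      then obtain a b c d a' b' c' d' where
        abcd: "a \<in> \<rat>" "b \<in> \<rat>" "c \<in> \<rat>" "d \<in> \<rat>" "a' \<in> \<rat>" "b' \<in> \<rat>" "c' \<in> \<rat>" "d' \<in> \<rat>"
        and xy: "x = cubic omega8 a b c d" "y = cubic omega8 a' b' c' d'"
        by (elim omega8_spanE)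
      show "\<sigma> (x \<otimes>\<^bsub>ringF\<^esub> y) = \<sigma> x \<otimes>\<^bsub>ringC\<^esub> \<sigma> y"
        by (simp only: ringF_simps ring_of_type_algebra_simps xy cubic_mult[OF omega8_pow4]
            cubic_mult[OF \<zeta>] \<sigma> abcd Rats_add Rats_diff Rats_mult)
      show "\<sigma> (x \<oplus>\<^bsub>ringF\<^esub> y) = \<sigma> x \<oplus>\<^bsub>ringC\<^esub> \<sigma> y"
        by (simp only: ringF_simps ring_of_type_algebra_simps xy cubic_add \<sigma> abcd Rats_add)
    next
      show "\<sigma> \<one>\<^bsub>ringF\<^esub> = \<one>\<^bsub>ringC\<^esub>" using \<sigma>[of 1 0 0 0] by (simp add: cubic_def)
    qed auto
    then have "\<sigma> \<in> embeddings" by (auto simp: embeddings_def \<sigma>_def)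
    moreover have "\<sigma> omega8 = \<zeta>" using \<sigma>[of 0 1 0 0] by (simp add: cubic_def)
    ultimately show "\<zeta> \<in> (\<lambda>\<sigma>. \<sigma> omega8) ` embeddings" by blast
  qed
qed

lemma roots_of_pow4_eq_minus_1:
  "{\<zeta>::complex. \<zeta> ^ 4 = -1} = {omega8, \<i> * omega8, - omega8, - (\<i> * omega8)}"
proof -
  have "\<zeta> ^ 4 + 1 = (\<zeta> - omega8) * (\<zeta> + omega8) * (\<zeta> - \<i> * omega8) * (\<zeta> + \<i> * omega8)" for \<zeta>
  proof -
    have "(\<zeta> - omega8) * (\<zeta> + omega8) * (\<zeta> - \<i> * omega8) * (\<zeta> + \<i> * omega8)
        = (\<zeta> ^ 2 - omega8 ^ 2) * (\<zeta> ^ 2 - (\<i> * omega8) ^ 2)"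
      by (simp add: power2_eq_square algebra_simps)
    also have "\<dots> = (\<zeta> ^ 2 - \<i>) * (\<zeta> ^ 2 + \<i>)" by (simp add: power_mult_distrib omega8_square)
    also have "\<dots> = \<zeta> ^ 4 + 1" by (simp add: power2_eq_square power4_eq_xxxx algebra_simps)
    finally show ?thesis by simp
  qed
  then have "\<zeta> ^ 4 = -1 \<longleftrightarrow> (\<zeta> - omega8) * (\<zeta> + omega8) * (\<zeta> - \<i> * omega8) * (\<zeta> + \<i> * omega8) = 0" for \<zeta>
    by (simp add: eq_neg_iff_add_eq_0)
  then have "\<zeta> ^ 4 = -1 \<longleftrightarrow> \<zeta> = omega8 \<or> \<zeta> = \<i> * omega8 \<or> \<zeta> = - omega8 \<or> \<zeta> = - (\<i> * omega8)" for \<zeta>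
    by (simp only: mult_eq_0_iff right_minus_eq eq_neg_iff_add_eq_0) blast
  then show ?thesis by blast
qed

text \<open>
  The sum of \<open>\<zeta> ^ j\<close> over the roots \<open>\<zeta>\<close> of \<open>X^4 + 1\<close> vanishes for \<open>j = 1, 2, 3\<close>.
\<close>

lemma traceF_cubic:
  assumes "a \<in> \<rat>" "b \<in> \<rat>" "c \<in> \<rat>" "d \<in> \<rat>"
  shows "traceF (cubic omega8 a b c d) = 4 * a"
proof -
  have w0: "omega8 \<noteq> 0" by (simp add: omega8_def)
  have "distinct (map (\<lambda>u. u * omega8) [1, \<i>, -1, - \<i>])"
    unfolding distinct_map using w0 by (auto simp: inj_on_def complex_eq_iff)
  then have dist: "distinct [omega8, \<i> * omega8, - omega8, - (\<i> * omega8)]" by simp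
  have "traceF (cubic omega8 a b c d) = (\<Sum>\<sigma>\<in>embeddings. cubic (\<sigma> omega8) a b c d)"
    unfolding traceF_def using assms by (intro sum.cong refl embedding_cubic)
  also have "\<dots> = (\<Sum>\<zeta> | \<zeta> ^ 4 = -1. cubic \<zeta> a b c d)"
    by (rule sum.reindex_bij_betw[OF bij_betw_embeddings])
  also have "\<dots> = cubic omega8 a b c d + cubic (\<i> * omega8) a b c d + cubic (- omega8) a b c d
      + cubic (- (\<i> * omega8)) a b c d"
    unfolding roots_of_pow4_eq_minus_1 using dist by (simp add: add.assoc)
  also have "\<dots> = 4 * a + 2 * c * (omega8 ^ 2 + (\<i> * omega8) ^ 2)"
    by (simp add: cubic_def power3_eq_cube power2_eq_square algebra_simps)
  also have "\<dots> = 4 * a" by (simp add: power_mult_distrib)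
  finally show ?thesis .
qed

lemma traceF_add: "x \<in> F8 \<Longrightarrow> y \<in> F8 \<Longrightarrow> traceF (x + y) = traceF x + traceF y"
  unfolding F8_eq_span omega8_span_def by (clarsimp simp: cubic_add traceF_cubic)

lemma traceF_O8_quarter: "y \<in> O8 \<Longrightarrow> traceF (y / 4) \<in> \<int>"
proof -
  assume "y \<in> O8"
  then obtain a b c d where abcd: "a \<in> \<int>" "b \<in> \<int>" "c \<in> \<int>" "d \<in> \<int>" "y = cubic omega8 a b c d"
    by (auto simp: O8_eq_span omega8_span_def)
  have R: "\<int> \<subseteq> (\<rat> :: complex set)" by (auto elim!: Ints_cases)
  have "y / 4 = cubic omega8 (a / 4) (b / 4) (c / 4) (d / 4)"
    by (simp add: abcd cubic_def field_simps)
  then have "traceF (y / 4) = 4 * (a / 4)"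
    using abcd R by (simp only:) (rule traceF_cubic; auto)
  then show ?thesis using abcd by simp
qed

text \<open>
  Up to the factor 4, the coordinates of \<open>x\<close> are the traces of \<open>x * omega8 ^ (- j)\<close> for \<open>j = 0, 1, 2, 3\<close>,
  where \<open>omega8 ^ (- j) = - (omega8 ^ (4 - j))\<close> for positive \<open>j\<close>.
\<close>

lemma codifferent_times_4:
  assumes "x \<in> codifferent" shows "4 * x \<in> O8"
proof -
  obtain a b c d where abcd: "a \<in> \<rat>" "b \<in> \<rat>" "c \<in> \<rat>" "d \<in> \<rat>" and x: "x = cubic omega8 a b c d"
    using assms by (auto simp: codifferent_def F8_eq_span omega8_span_def)
  have tr: "y \<in> O8 \<Longrightarrow> traceF (x * y) \<in> \<int>" for y using assms by (auto simp: codifferent_def)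
  have "4 * a \<in> \<int>" using tr[of 1] abcd by (simp add: x traceF_cubic)
  moreover have "4 * b \<in> \<int>"
    using tr[of "cubic omega8 0 0 0 (-1)"] abcd
    by (simp add: x cubic_mult[OF omega8_pow4] traceF_cubic O8_eq_span omega8_spanI)
  moreover have "4 * c \<in> \<int>"
    using tr[of "cubic omega8 0 0 (-1) 0"] abcd
    by (simp add: x cubic_mult[OF omega8_pow4] traceF_cubic O8_eq_span omega8_spanI)
  moreover have "4 * d \<in> \<int>"
    using tr[of "cubic omega8 0 (-1) 0 0"] abcd
    by (simp add: x cubic_mult[OF omega8_pow4] traceF_cubic O8_eq_span omega8_spanI)
  moreover have "4 * x = cubic omega8 (4 * a) (4 * b) (4 * c) (4 * d)"
    by (simp add: x cubic_def algebra_simps)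
  ultimately show ?thesis by (simp add: O8_eq_span omega8_spanI)
qed

lemma mem_PIdl_iff: "x \<in> PIdl\<^bsub>ringO\<^esub> c \<longleftrightarrow> (\<exists>r\<in>O8. x = r * c)"
  by (auto simp: cgenideal_def)

text \<open>
  By \<open>codifferent_times_4\<close> the different contains 4, so \<open>4 = u * \<delta>\<close> with integral \<open>u\<close>, and
  \<open>y / \<delta> = y * u / 4\<close>.
\<close>

lemma traceF_divide_different_generator:
  assumes "different_generator \<delta>" "y \<in> O8"
  shows "traceF (y / \<delta>) \<in> \<int>"
proof -
  have "4 \<in> different"
    unfolding different_def
  proof (intro CollectI conjI ballI)
    show "4 \<in> F8" by (intro F8_Rat) auto
    show "4 * x \<in> O8" if "x \<in> codifferent" for x using that by (rule codifferent_times_4)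
  qed
  then have "4 \<in> PIdl\<^bsub>ringO\<^esub> \<delta>"
    using assms(1) unfolding different_generator_def by blast
  then obtain u where u: "u \<in> O8" "4 = u * \<delta>" by (auto simp only: mem_PIdl_iff)
  have "\<delta> \<noteq> 0" "u \<noteq> 0" using u(2) by auto
  then have "y / \<delta> = y * u / (u * \<delta>)" by simp
  then have "y / \<delta> = y * u / 4" unfolding u(2)[symmetric] .
  then show ?thesis using traceF_O8_quarter[of "y * u"] assms u by auto
qed

lemma add_char_add:
  assumes "different_generator \<delta>" "x \<in> F8" "y \<in> F8"
  shows "add_char \<delta> (x + y) = add_char \<delta> x * add_char \<delta> y"
proof -
  have "\<delta> \<in> F8" using assms(1) O8_subset_F8 by (auto simp: different_generator_def)
  then have "traceF ((x + y) / \<delta>) = traceF (x / \<delta>) + traceF (y / \<delta>)"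
    using assms by (simp add: add_divide_distrib traceF_add F8_divide)
  then show ?thesis by (simp add: add_char_def distrib_left exp_add)
qed

lemma add_char_O8:
  assumes "different_generator \<delta>" "y \<in> O8"
  shows "add_char \<delta> y = 1"
proof -
  obtain n where n: "traceF (y / \<delta>) = of_int n"
    using traceF_divide_different_generator[OF assms] by (auto elim!: Ints_cases)
  have "add_char \<delta> y = cis (2 * pi * of_int n)"
    by (simp add: add_char_def n cis_conv_exp mult_ac)
  then show ?thesis by (simp add: cis_multiple_2pi)
qed

section \<open>Congruences modulo a prime element\<close>

lemma domain_ringO: "domain ringO"
proof -
  have "cring ringO"
  proof (rule cringI)
    show "abelian_group ringO"
      by (rule abelian_groupI) (auto simp: add.assoc add.commute intro: bexI[of _ "- x" for x])
    show "comm_monoid ringO" by (rule comm_monoidI) (auto simp: mult.assoc mult.commute)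
  qed (auto simp: distrib_right)
  then show ?thesis by (rule domain.intro) (unfold_locales, auto)
qed

lemma Units_ringO: "x \<in> Units ringO \<longleftrightarrow> x \<in> O8 \<and> (\<exists>y\<in>O8. x * y = 1)"
  by (auto simp: Units_def mult.commute)

lemma divides_ringO: "a divides\<^bsub>ringO\<^esub> b \<longleftrightarrow> (\<exists>c\<in>O8. b = a * c)"
  by (auto simp: factor_def)

locale prime_modulus =
  fixes p :: complex
  assumes p_O8: "p \<in> O8" and ring_prime_p: "ring_prime\<^bsub>ringO\<^esub> p"
    and norm_mod_4: "abs_norm p mod 4 = 1"
begin

sublocale O: domain ringO by (rule domain_ringO)

abbreviation P :: "complex set" where "P \<equiv> PIdl\<^bsub>ringO\<^esub> p"

lemma p_neq_0: "p \<noteq> 0"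
  using ring_prime_p by (simp add: ring_prime_def)

sublocale P: primeideal P ringO
  using O.primeideal_iff_prime[of p] p_O8 p_neq_0 ring_prime_p by simp

lemma P_subset_O8: "x \<in> P \<Longrightarrow> x \<in> O8"
  using P.Icarr by simp

lemma P_closed:
  shows P_0: "0 \<in> P" and P_add: "x \<in> P \<Longrightarrow> y \<in> P \<Longrightarrow> x + y \<in> P"
    and P_mult_left: "x \<in> P \<Longrightarrow> y \<in> O8 \<Longrightarrow> y * x \<in> P"
    and P_mult_right: "x \<in> P \<Longrightarrow> y \<in> O8 \<Longrightarrow> x * y \<in> P"
    and P_uminus: "x \<in> P \<Longrightarrow> - x \<in> P" and P_diff: "x \<in> P \<Longrightarrow> y \<in> P \<Longrightarrow> x - y \<in> P"
proof -
  show "0 \<in> P" using P.zero_closed by simp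
  show add: "x + y \<in> P" if "x \<in> P" "y \<in> P" for x y using P.a_closed[OF that] by simp
  show "y * x \<in> P" if "x \<in> P" "y \<in> O8" for x y using P.I_l_closed[of x y] that by simp
  show mult: "x * y \<in> P" if "x \<in> P" "y \<in> O8" for x y using P.I_r_closed[of x y] that by simp
  show uminus: "- x \<in> P" if "x \<in> P" for x using mult[OF that, of "- 1"] by simp
  show "x - y \<in> P" if "x \<in> P" "y \<in> P" for x y using add[OF that(1) uminus[OF that(2)]] by simp
qed

lemma P_prime: "x \<in> O8 \<Longrightarrow> y \<in> O8 \<Longrightarrow> x * y \<in> P \<longleftrightarrow> x \<in> P \<or> y \<in> P"
  using P.I_prime[of x y] P_mult_left P_mult_right by auto

lemma one_notin_P: "1 \<notin> P"
proof
  assume "1 \<in> P"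
  then have "carrier ringO \<subseteq> P" using P_mult_left[of 1] by auto
  then show False using P.I_notcarr P_subset_O8 by auto
qed

lemma P_power: "x \<in> O8 \<Longrightarrow> x ^ n \<in> P \<Longrightarrow> x \<in> P"
  by (induction n) (use P_prime one_notin_P in auto)

text \<open>
  Membership in \<open>O8\<close> is part of the congruence, so that the compatibility rules below need no side
  conditions.
\<close>

definition cg :: "complex \<Rightarrow> complex \<Rightarrow> bool" (infix \<open>\<approx>\<close> 50) where
  "x \<approx> y \<longleftrightarrow> x \<in> O8 \<and> y \<in> O8 \<and> x - y \<in> P"

lemma cg_O8: "x \<approx> y \<Longrightarrow> x \<in> O8" "x \<approx> y \<Longrightarrow> y \<in> O8"
  by (auto simp: cg_def)

lemma cg_refl [simp]: "x \<approx> x \<longleftrightarrow> x \<in> O8"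
  by (auto simp: cg_def P_0)

lemma cg_sym: "x \<approx> y \<Longrightarrow> y \<approx> x"
  using P_uminus[of "x - y"] by (auto simp: cg_def)

lemma cg_trans [trans]: "x \<approx> y \<Longrightarrow> y \<approx> z \<Longrightarrow> x \<approx> z"
  using P_add[of "x - y" "y - z"] by (auto simp: cg_def)

lemma cg_add: "x \<approx> y \<Longrightarrow> x' \<approx> y' \<Longrightarrow> x + x' \<approx> y + y'"
  using P_add[of "x - y" "x' - y'"] by (auto simp: cg_def algebra_simps)

lemma cg_uminus: "x \<approx> y \<Longrightarrow> - x \<approx> - y"
  using P_uminus[of "x - y"] by (auto simp: cg_def)

lemma cg_diff: "x \<approx> y \<Longrightarrow> x' \<approx> y' \<Longrightarrow> x - x' \<approx> y - y'"
  using cg_add[OF _ cg_uminus, of x y x' y'] by simp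

lemma cg_mult: "x \<approx> y \<Longrightarrow> x' \<approx> y' \<Longrightarrow> x * x' \<approx> y * y'"
proof -
  assume *: "x \<approx> y" "x' \<approx> y'"
  then have "(x - y) * x' + y * (x' - y') \<in> P"
    by (intro P_add P_mult_left P_mult_right) (auto simp: cg_def)
  then show ?thesis using * by (auto simp: cg_def algebra_simps)
qed

lemma cg_power: "x \<approx> y \<Longrightarrow> x ^ n \<approx> y ^ n"
  by (induction n) (auto intro: cg_mult)

lemma cg_sum: "(\<And>i. i \<in> A \<Longrightarrow> f i \<approx> g i) \<Longrightarrow> sum f A \<approx> sum g A"
  by (induction A rule: infinite_finite_induct) (auto intro: cg_add)

lemma cg_prod: "(\<And>i. i \<in> A \<Longrightarrow> f i \<approx> g i) \<Longrightarrow> prod f A \<approx> prod g A"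
  by (induction A rule: infinite_finite_induct) (auto intro: cg_mult)

lemma cg_P: "x \<approx> y \<Longrightarrow> x \<in> P \<longleftrightarrow> y \<in> P"
  using P_add[of "x - y" y] P_diff[of x "x - y"] by (auto simp: cg_def)

lemma cg_0_iff: "x \<approx> 0 \<longleftrightarrow> x \<in> P" "0 \<approx> x \<longleftrightarrow> x \<in> P"
proof -
  show x: "x \<approx> 0 \<longleftrightarrow> x \<in> P" using P_subset_O8[of x] unfolding cg_def by (simp, blast)
  then show "0 \<approx> x \<longleftrightarrow> x \<in> P" using cg_sym by blast
qed

lemma cg_iff_diff: "x \<in> O8 \<Longrightarrow> y \<in> O8 \<Longrightarrow> x \<approx> y \<longleftrightarrow> x - y \<in> P"
  by (simp add: cg_def)

lemma cg_cancel:
  assumes "x \<in> O8" "x \<notin> P" "a \<in> O8" "b \<in> O8" "x * a \<approx> x * b"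
  shows "a \<approx> b"
proof -
  have "x * (a - b) \<in> P" using assms(5) by (simp add: cg_def algebra_simps)
  then show ?thesis using assms P_prime[of x "a - b"] by (auto simp: cg_def)
qed

abbreviation coset :: "complex \<Rightarrow> complex set" where
  "coset x \<equiv> P +>\<^bsub>ringO\<^esub> x"

lemma coset_eq: "x \<in> O8 \<Longrightarrow> coset x = {y. y \<approx> x}"
proof -
  assume x: "x \<in> O8"
  have "y \<in> coset x \<longleftrightarrow> y \<approx> x" for y
  proof -
    have "y \<in> coset x \<longleftrightarrow> (\<exists>h\<in>P. y = h + x)" by (auto simp: a_r_coset_def r_coset_def)
    also have "\<dots> \<longleftrightarrow> y - x \<in> P" by (auto intro!: bexI[of _ "y - x"])
    also have "\<dots> \<longleftrightarrow> y \<approx> x" using x P_subset_O8[of "y - x"] O8_add[of "y - x" x] by (auto simp: cg_def)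
    finally show ?thesis .
  qed
  then show ?thesis by blast
qed

lemma coset_eq_iff: "x \<in> O8 \<Longrightarrow> y \<in> O8 \<Longrightarrow> coset x = coset y \<longleftrightarrow> x \<approx> y"
  by (auto simp: coset_eq intro: cg_sym cg_trans dest: equalityD1)

abbreviation K :: "complex set ring" where
  "K \<equiv> residue_ring_mod p"

lemma carrier_K: "carrier K = coset ` O8"
  by (auto simp: FactRing_def A_RCOSETS_def RCOSETS_def a_r_coset_def)

lemma mult_K: "x \<in> O8 \<Longrightarrow> y \<in> O8 \<Longrightarrow> coset x \<otimes>\<^bsub>K\<^esub> coset y = coset (x * y)"
  using P.rcoset_mult_add[of x y] by (simp add: FactRing_def)

lemma one_K: "\<one>\<^bsub>K\<^esub> = coset 1"
  by (simp add: FactRing_def)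

lemma zero_K: "\<zero>\<^bsub>K\<^esub> = coset 0"
  by (simp add: FactRing_def coset_eq cg_0_iff)

lemma coset_eq_zero_iff: "x \<in> O8 \<Longrightarrow> coset x = \<zero>\<^bsub>K\<^esub> \<longleftrightarrow> x \<in> P"
  by (simp add: zero_K coset_eq_iff cg_0_iff)

text \<open>
  The representative at which \<open>residue_sum\<close> evaluates its summand on the class of \<open>x\<close>.
\<close>

definition red :: "complex \<Rightarrow> complex" where
  "red x = residue_rep (coset x)"

definition R :: "complex set" where
  "R = red ` O8"

lemma red_cg: "x \<in> O8 \<Longrightarrow> red x \<approx> x"
  using someI[of "\<lambda>y. y \<in> coset x" x] by (simp add: red_def residue_rep_def coset_eq)

lemma red_eq_iff: "x \<in> O8 \<Longrightarrow> y \<in> O8 \<Longrightarrow> red x = red y \<longleftrightarrow> x \<approx> y"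
  using red_cg[of x] red_cg[of y] coset_eq_iff[of x y]
  by (metis cg_sym cg_trans red_def)

lemma red_in_R: "x \<in> O8 \<Longrightarrow> red x \<in> R"
  by (simp add: R_def)

lemma R_subset_O8: "r \<in> R \<Longrightarrow> r \<in> O8"
  using red_cg by (auto simp: R_def cg_def)

lemma red_R: "r \<in> R \<Longrightarrow> red r = r"
  using red_cg red_eq_iff by (auto simp: R_def cg_def)

lemma R_cg_imp_eq: "r \<in> R \<Longrightarrow> s \<in> R \<Longrightarrow> r \<approx> s \<Longrightarrow> r = s"
  using red_eq_iff[of r s] red_R R_subset_O8 by metis

lemma bij_betw_residue_rep: "bij_betw residue_rep (carrier K) R"
proof -
  have "inj_on residue_rep (carrier K)"
  proof (rule inj_onI)
    fix C D assume "C \<in> carrier K" "D \<in> carrier K" and eq: "residue_rep C = residue_rep D"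
    then obtain x y where xy: "x \<in> O8" "y \<in> O8" "C = coset x" "D = coset y"
      by (auto simp: carrier_K)
    then have "red x = red y" using eq by (simp add: red_def)
    then show "C = D" using xy red_eq_iff coset_eq_iff by simp
  qed
  moreover have "residue_rep ` carrier K = R"
    by (simp add: carrier_K R_def red_def image_image)
  ultimately show ?thesis by (simp add: bij_betw_def)
qed

lemma residue_sum_eq: "residue_sum p f = sum f R"
  unfolding residue_sum_def by (rule sum.reindex_bij_betw[OF bij_betw_residue_rep])

lemma card_R: "card R = abs_norm p"
  unfolding abs_norm_def by (rule bij_betw_same_card[OF bij_betw_residue_rep, symmetric])

text \<open>
  The cardinality of an infinite set is 0, so the norm being 1 modulo 4 entails that there are only
  finitely many residue classes.
\<close>

lemma norm_pos: "abs_norm p > 0" "odd (abs_norm p)" "abs_norm p > 1"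
proof -
  show pos: "abs_norm p > 0" and "odd (abs_norm p)" using norm_mod_4 by presburger+
  have "{red 0, red 1} \<subseteq> R" "red 0 \<noteq> red 1"
    using red_eq_iff[of 0 1] one_notin_P by (auto simp: red_in_R cg_0_iff)
  moreover have "finite R" using pos card_R by (metis card.infinite less_numeral_extra(3))
  ultimately have "card {red 0, red 1} \<le> card R" by (intro card_mono)
  then show "abs_norm p > 1" using \<open>red 0 \<noteq> red 1\<close> by (simp add: card_R)
qed

lemma finite_R [simp]: "finite R"
  using norm_pos(1) card_R by (metis card.infinite less_numeral_extra(3))

definition U :: "complex set" where
  "U = {r \<in> R. r \<notin> P}"

lemma U_iff: "r \<in> U \<longleftrightarrow> r \<in> R \<and> r \<notin> P"
  by (simp add: U_def)

lemma finite_U [simp]: "finite U"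
  by (simp add: U_def)

lemma U_O8: "x \<in> U \<Longrightarrow> x \<in> O8" "x \<in> U \<Longrightarrow> x \<notin> P"
  using R_subset_O8 by (auto simp: U_iff)

lemma R_eq_insert_U: "R = insert (red 0) U" "red 0 \<notin> U"
proof -
  have "r = red 0 \<longleftrightarrow> r \<in> P" if "r \<in> R" for r
    using that red_eq_iff[of r 0] red_R[of r] R_subset_O8 by (simp add: cg_0_iff)
  moreover have "red 0 \<in> R" by (simp add: red_in_R)
  ultimately show "R = insert (red 0) U" "red 0 \<notin> U" by (auto simp: U_iff)
qed

lemma card_U: "card U = abs_norm p - 1"
  using card_R R_eq_insert_U by simp

text \<open>
  The substitution \<open>x = \<phi> y\<close> in a sum over residue classes satisfying a condition: \<open>\<phi>\<close> and \<open>\<psi>\<close> only have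
  to be inverse to each other modulo \<open>p\<close>. With the constant 1 as \<open>F\<close> it says that two solution sets
  have the same number of classes.
\<close>

lemma sum_reindex:
  fixes F :: "complex \<Rightarrow> complex"
  assumes F: "\<And>x y. x \<approx> y \<Longrightarrow> B x \<Longrightarrow> F x = F y"
    and A: "\<And>x y. x \<approx> y \<Longrightarrow> A x \<Longrightarrow> A y" and B: "\<And>x y. x \<approx> y \<Longrightarrow> B x \<Longrightarrow> B y"
    and \<phi>: "\<And>x y. x \<approx> y \<Longrightarrow> A x \<Longrightarrow> \<phi> x \<approx> \<phi> y" "\<And>x. x \<in> O8 \<Longrightarrow> A x \<Longrightarrow> B (\<phi> x)"
      "\<And>x. x \<in> O8 \<Longrightarrow> A x \<Longrightarrow> \<psi> (\<phi> x) \<approx> x"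
    and \<psi>: "\<And>x y. x \<approx> y \<Longrightarrow> B x \<Longrightarrow> \<psi> x \<approx> \<psi> y" "\<And>x. x \<in> O8 \<Longrightarrow> B x \<Longrightarrow> A (\<psi> x)"
      "\<And>x. x \<in> O8 \<Longrightarrow> B x \<Longrightarrow> \<phi> (\<psi> x) \<approx> x"
  shows "(\<Sum>x | x \<in> R \<and> A x. F (\<phi> x)) = (\<Sum>x | x \<in> R \<and> B x. F x)"
proof (rule sum.reindex_bij_witness[where j = "\<lambda>x. red (\<phi> x)" and i = "\<lambda>x. red (\<psi> x)"])
  fix x assume "x \<in> {x. x \<in> R \<and> A x}"
  then have x: "x \<in> O8" "x \<in> R" "A x" using R_subset_O8 by auto
  have o: "\<phi> x \<in> O8" using \<phi>(1)[of x x] x by simp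
  have c: "red (\<phi> x) \<approx> \<phi> x" using red_cg[OF o] .
  have b: "B (red (\<phi> x))" using B[OF cg_sym[OF c]] \<phi>(2)[of x] x by simp
  have "\<psi> (red (\<phi> x)) \<approx> \<psi> (\<phi> x)" using \<psi>(1)[OF c b] .
  also have "\<psi> (\<phi> x) \<approx> x" using \<phi>(3) x by simp
  finally have d: "\<psi> (red (\<phi> x)) \<approx> x" .
  then have "red (\<psi> (red (\<phi> x))) = red x" using red_eq_iff cg_O8 by metis
  then show "red (\<psi> (red (\<phi> x))) = x" using red_R x by simp
  show "red (\<phi> x) \<in> {x. x \<in> R \<and> B x}" using b red_in_R o by simp
  show "F (red (\<phi> x)) = F (\<phi> x)" using F[OF c b] .
next
  fix x assume "x \<in> {x. x \<in> R \<and> B x}"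
  then have x: "x \<in> O8" "x \<in> R" "B x" using R_subset_O8 by auto
  have o: "\<psi> x \<in> O8" using \<psi>(1)[of x x] x by simp
  have c: "red (\<psi> x) \<approx> \<psi> x" using red_cg[OF o] .
  have b: "A (red (\<psi> x))" using A[OF cg_sym[OF c]] \<psi>(2)[of x] x by simp
  have "\<phi> (red (\<psi> x)) \<approx> \<phi> (\<psi> x)" using \<phi>(1)[OF c b] .
  also have "\<phi> (\<psi> x) \<approx> x" using \<psi>(3) x by simp
  finally have d: "\<phi> (red (\<psi> x)) \<approx> x" .
  then have "red (\<phi> (red (\<psi> x))) = red x" using red_eq_iff cg_O8 by metis
  then show "red (\<phi> (red (\<psi> x))) = x" using red_R x by simp
  show "red (\<psi> x) \<in> {x. x \<in> R \<and> A x}" using b red_in_R o by simp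
qed

lemma sum_reindex_R:
  fixes F :: "complex \<Rightarrow> complex"
  assumes "\<And>x y. x \<approx> y \<Longrightarrow> F x = F y"
    and "\<And>x y. x \<approx> y \<Longrightarrow> \<phi> x \<approx> \<phi> y" "\<And>x. x \<in> O8 \<Longrightarrow> \<psi> (\<phi> x) \<approx> x"
    and "\<And>x y. x \<approx> y \<Longrightarrow> \<psi> x \<approx> \<psi> y" "\<And>x. x \<in> O8 \<Longrightarrow> \<phi> (\<psi> x) \<approx> x"
  shows "(\<Sum>x\<in>R. F (\<phi> x)) = (\<Sum>x\<in>R. F x)"
  using sum_reindex[of "\<lambda>_. True" F "\<lambda>_. True" \<phi> \<psi>] assms by simp

lemma sum_fibres:
  fixes h :: "complex \<Rightarrow> complex"
  assumes "finite S" "\<And>y. y \<in> S \<Longrightarrow> \<sigma> y \<in> O8"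
  shows "(\<Sum>y\<in>S. h y) = (\<Sum>s\<in>R. \<Sum>y | y \<in> S \<and> \<sigma> y \<approx> s. h y)"
proof -
  have eq: "{y \<in> S. red (\<sigma> y) = s} = {y. y \<in> S \<and> \<sigma> y \<approx> s}" if "s \<in> R" for s
    using assms(2) red_eq_iff[of "\<sigma> y" s for y] red_R[OF that] R_subset_O8[OF that] by auto
  have "(\<Sum>y\<in>S. h y) = (\<Sum>s\<in>R. \<Sum>y\<in>{y \<in> S. red (\<sigma> y) = s}. h y)"
    using assms by (intro sum.group[symmetric]) (auto intro: red_in_R)
  also have "\<dots> = (\<Sum>s\<in>R. \<Sum>y | y \<in> S \<and> \<sigma> y \<approx> s. h y)"
    by (intro sum.cong refl eq)
  finally show ?thesis .
qed

section \<open>The multiplicative group of the residue field\<close>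

text \<open>
  Multiplication by \<open>x\<close> is injective on the finitely many residue classes, hence surjective.
\<close>

lemma ex_inverse:
  assumes "x \<in> O8" "x \<notin> P"
  shows "\<exists>z\<in>O8. x * z \<approx> 1"
proof -
  have "inj_on (\<lambda>r. red (x * r)) R"
  proof (rule inj_onI)
    fix r s assume rs: "r \<in> R" "s \<in> R" "red (x * r) = red (x * s)"
    have o: "r \<in> O8" "s \<in> O8" using rs R_subset_O8 by auto
    then have "x * r \<approx> x * s" using rs(3) assms red_eq_iff[of "x * r" "x * s"] by simp
    then have "r \<approx> s" using cg_cancel assms o by blast
    then show "r = s" using rs R_cg_imp_eq by blast
  qed
  moreover have "(\<lambda>r. red (x * r)) ` R \<subseteq> R"
    using assms R_subset_O8 by (intro image_subsetI red_in_R O8_mult)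
  ultimately have "(\<lambda>r. red (x * r)) ` R = R" by (simp add: endo_inj_surj)
  then have "red 1 \<in> (\<lambda>r. red (x * r)) ` R" using red_in_R[of 1] by simp
  then obtain r where r: "r \<in> R" "red 1 = red (x * r)" by (rule imageE)
  have "r \<in> O8" using R_subset_O8[OF r(1)] .
  moreover from this have "x * r \<approx> 1" using assms red_eq_iff[of "x * r" 1] r(2) by simp
  ultimately show ?thesis by blast
qed

lemma inv_mod_props:
  assumes "x \<in> O8" "x \<notin> P"
  shows inv_O8: "inv_mod p x \<in> O8" and inv_cg: "x * inv_mod p x \<approx> 1"
    and inv_notin_P: "inv_mod p x \<notin> P"
proof -
  have "\<exists>z. z \<in> O8 \<and> x * z - 1 \<in> P" using ex_inverse[OF assms] by (auto simp: cg_def)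
  from someI_ex[OF this] show i: "inv_mod p x \<in> O8" and c: "x * inv_mod p x \<approx> 1"
    using assms(1) by (auto simp: inv_mod_def cg_def)
  show "inv_mod p x \<notin> P" using c cg_P[OF c] P_mult_left assms(1) one_notin_P by auto
qed

lemma inv_unique:
  assumes "x \<in> O8" "x \<notin> P" "z \<in> O8" "x * z \<approx> 1"
  shows "inv_mod p x \<approx> z"
proof (rule cg_cancel[OF assms(1,2) inv_O8[OF assms(1,2)] assms(3)])
  show "x * inv_mod p x \<approx> x * z" using inv_cg[OF assms(1,2)] cg_sym[OF assms(4)] by (rule cg_trans)
qed

lemma inv_mod_cong:
  assumes "x \<approx> y" "x \<notin> P"
  shows "inv_mod p x \<approx> inv_mod p y"
proof -
  have y: "x \<in> O8" "y \<in> O8" "y \<notin> P" using assms cg_O8 cg_P by auto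
  have "x * inv_mod p y \<approx> y * inv_mod p y" using assms(1) inv_O8[of y] y by (intro cg_mult) auto
  also have "\<dots> \<approx> 1" using inv_cg y by simp
  finally show ?thesis using y assms inv_O8 by (intro inv_unique) auto
qed

lemma Units_K: "Units K = coset ` (O8 - P)"
proof (intro subset_antisym subsetI)
  fix C assume "C \<in> Units K"
  then obtain D where CD: "C \<in> carrier K" "D \<in> carrier K" "C \<otimes>\<^bsub>K\<^esub> D = \<one>\<^bsub>K\<^esub>"
    by (auto simp: Units_def)
  then obtain x y where xy: "x \<in> O8" "C = coset x" "y \<in> O8" "D = coset y"
    by (auto simp: carrier_K)
  then have "x * y \<approx> 1" using CD(3) by (simp add: mult_K one_K coset_eq_iff)
  then have "x \<notin> P" using cg_P one_notin_P P_mult_right xy by blast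
  then show "C \<in> coset ` (O8 - P)" using xy by auto
next
  fix C assume "C \<in> coset ` (O8 - P)"
  then obtain x where x: "x \<in> O8" "x \<notin> P" "C = coset x" by auto
  then have "coset (inv_mod p x) \<otimes>\<^bsub>K\<^esub> C = \<one>\<^bsub>K\<^esub>" "C \<otimes>\<^bsub>K\<^esub> coset (inv_mod p x) = \<one>\<^bsub>K\<^esub>"
    using inv_O8[of x] inv_cg[of x] by (simp_all add: mult_K one_K coset_eq_iff mult.commute)
  then show "C \<in> Units K" using x inv_O8[of x] by (auto simp: Units_def carrier_K)
qed

lemma unit_residue_sum_eq: "unit_residue_sum p f = sum f U"
proof -
  have "residue_rep ` Units K = red ` (O8 - P)" by (simp add: Units_K image_image red_def)
  also have "\<dots> = U"
  proof (intro subset_antisym subsetI)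
    fix y assume "y \<in> red ` (O8 - P)"
    then obtain x where x: "x \<in> O8" "x \<notin> P" "y = red x" by blast
    then show "y \<in> U" using red_in_R[of x] cg_P[OF red_cg[of x]] by (simp add: U_iff)
  next
    fix y assume y: "y \<in> U"
    then have "y = red y" using red_R[of y] by (simp add: U_iff)
    then show "y \<in> red ` (O8 - P)" using U_O8[OF y] by blast
  qed
  finally have 1: "residue_rep ` Units K = U" .
  have "Units K \<subseteq> carrier K" by (auto simp: Units_def)
  then have "bij_betw residue_rep (Units K) U"
    using bij_betw_subset[OF bij_betw_residue_rep _ 1] by blast
  then show ?thesis unfolding unit_residue_sum_def by (rule sum.reindex_bij_betw)
qed

lemma field_K: "field K"
proof -
  have "cring K" using P.quotient_is_cring O.is_cring by simp
  moreover have "Units K = carrier K - {\<zero>\<^bsub>K\<^esub>}"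
    unfolding Units_K carrier_K using coset_eq_zero_iff by blast
  ultimately show ?thesis by (rule cring.cring_fieldI)
qed

text \<open>
  A generator of the multiplicative group of the finite field \<open>K\<close>, lifted to \<open>O8\<close>.
\<close>

lemma primitive_root:
  obtains g where "g \<in> O8" "g \<notin> P" "\<And>x. x \<in> O8 \<Longrightarrow> x \<notin> P \<Longrightarrow> \<exists>k. x \<approx> g ^ k"
proof -
  interpret K: field K by (rule field_K)
  have "finite (carrier K)" using norm_pos(1) unfolding abs_norm_def by (rule card_ge_0_finite)
  from K.finite_field_mult_group_has_gen[OF this, unfolded Multiplicative_Group.carrier_mult_of]
  obtain a where a: "a \<in> carrier K - {\<zero>\<^bsub>K\<^esub>}"
      "carrier K - {\<zero>\<^bsub>K\<^esub>} = {a [^]\<^bsub>K\<^esub> i | i::nat. i \<in> UNIV}"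
    by (rule bexE)
  from a(1) obtain g where g: "g \<in> O8" "a = coset g" "a \<noteq> \<zero>\<^bsub>K\<^esub>"
    unfolding carrier_K by blast
  then have gP: "g \<notin> P" using coset_eq_zero_iff by simp
  have pow: "a [^]\<^bsub>K\<^esub> i = coset (g ^ i)" for i :: nat
    by (induction i) (simp_all add: g one_K mult_K mult.commute)
  have "\<exists>k. x \<approx> g ^ k" if "x \<in> O8" "x \<notin> P" for x
  proof -
    have "coset x \<in> carrier K - {\<zero>\<^bsub>K\<^esub>}"
      using that coset_eq_zero_iff[of x] unfolding carrier_K by blast
    then obtain k :: nat where "coset x = coset (g ^ k)" unfolding a(2) pow by blast
    then show ?thesis using coset_eq_iff[of x "g ^ k"] that g(1) by blast
  qed
  then show ?thesis using that g(1) gP by blast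
qed

text \<open>
  The shift \<open>r \<mapsto> r + 1\<close> permutes the residue classes; comparing the sums of all classes yields
  \<open>abs_norm p \<approx> 0\<close>. As \<open>abs_norm p\<close> is odd, \<open>2 \<approx> 0\<close> would imply \<open>1 \<approx> 0\<close>.
\<close>

lemma two_notin_P: "2 \<notin> P"
proof
  assume two: "2 \<in> P"
  have "(\<Sum>r\<in>R. red (r + 1)) = (\<Sum>r\<in>R. red r)"
    by (rule sum_reindex_R[where \<psi> = "\<lambda>x. x - 1"]) (auto intro!: cg_add cg_diff simp: red_eq_iff cg_O8)
  then have "(\<Sum>r\<in>R. red (r + 1)) = (\<Sum>r\<in>R. r)" using red_R by simp
  moreover have "(\<Sum>r\<in>R. red (r + 1)) \<approx> (\<Sum>r\<in>R. r + 1)"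
    by (intro cg_sum red_cg) (auto intro: R_subset_O8)
  ultimately have "(\<Sum>r\<in>R. r + 1) - (\<Sum>r\<in>R. r) \<in> P"
    using cg_sym by (metis cg_def)
  then have n: "of_nat (abs_norm p) \<in> P" by (simp add: sum.distrib card_R)
  obtain m where "abs_norm p = 2 * m + 1" using norm_pos(2) by (rule oddE)
  then have "of_nat (abs_norm p) - 2 * of_nat m = (1::complex)" by simp
  moreover have "2 * of_nat m \<in> P" using two O8_Int by (intro P_mult_right) auto
  ultimately show False using P_diff[OF n] one_notin_P by metis
qed

text \<open>
  Multiplication by \<open>x\<close> permutes the unit classes; compare the products of all of them.
\<close>

lemma fermat:
  assumes "x \<in> O8" "x \<notin> P"
  shows "x ^ (abs_norm p - 1) \<approx> 1"
proof -
  have bij: "bij_betw (\<lambda>r. red (x * r)) U U"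
  proof -
    have inj: "inj_on (\<lambda>r. red (x * r)) U"
    proof (rule inj_onI)
      fix r s assume rs: "r \<in> U" "s \<in> U" "red (x * r) = red (x * s)"
      have o: "r \<in> O8" "s \<in> O8" using rs U_O8 by auto
      then have "x * r \<approx> x * s" using rs(3) assms red_eq_iff[of "x * r" "x * s"] by simp
      then have "r \<approx> s" using cg_cancel assms o by blast
      then show "r = s" using rs R_cg_imp_eq U_iff by blast
    qed
    moreover have "(\<lambda>r. red (x * r)) ` U \<subseteq> U"
    proof
      fix y assume "y \<in> (\<lambda>r. red (x * r)) ` U"
      then obtain r where r: "r \<in> U" "y = red (x * r)" by auto
      then have "x * r \<in> O8" "x * r \<notin> P" using U_O8 assms P_prime by auto
      then show "y \<in> U" using r red_in_R red_cg[of "x * r"] cg_P by (auto simp: U_iff)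
    qed
    ultimately show ?thesis by (simp add: bij_betw_def endo_inj_surj)
  qed
  have "(\<Prod>r\<in>U. x * r) \<approx> (\<Prod>r\<in>U. red (x * r))"
    using assms U_O8 by (intro cg_prod cg_sym[OF red_cg]) auto
  also have "(\<Prod>r\<in>U. red (x * r)) = \<Prod>U" by (rule prod.reindex_bij_betw[OF bij])
  also have "(\<Prod>r\<in>U. x * r) = \<Prod>U * x ^ (abs_norm p - 1)"
    by (simp add: prod.distrib card_U mult.commute)
  finally have *: "\<Prod>U * x ^ (abs_norm p - 1) \<approx> \<Prod>U * 1" by simp
  have "finite S \<Longrightarrow> S \<subseteq> U \<Longrightarrow> \<Prod>S \<in> O8 \<and> \<Prod>S \<notin> P" for S
    by (induction S rule: finite_induct) (simp_all add: one_notin_P P_prime U_O8)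
  from this[of U] show ?thesis using cg_cancel[OF _ _ _ _ *] assms by simp
qed

section \<open>Quadratic and quartic residue symbols\<close>

abbreviation symbol :: "nat \<Rightarrow> complex \<Rightarrow> complex" (\<open>\<chi>\<close>) where
  "\<chi> n x \<equiv> prime_residue_symbol n x p"

lemma fourth_root_cases:
  fixes z :: complex
  assumes "z ^ 4 = 1"
  shows "z = 1 \<or> z = -1 \<or> z = \<i> \<or> z = - \<i>"
proof -
  have "(z - 1) * (z + 1) * (z - \<i>) * (z + \<i>) = z ^ 4 - 1"
    by (simp add: algebra_simps power4_eq_xxxx)
  then have "(z - 1) * (z + 1) * (z - \<i>) * (z + \<i>) = 0" using assms by simp
  then show ?thesis by (simp only: mult_eq_0_iff right_minus_eq eq_neg_iff_add_eq_0) blast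
qed

lemma neg_1_not_cg_1: "\<not> -1 \<approx> 1"
proof
  assume "-1 \<approx> 1"
  then have "-1 - 1 \<in> P" unfolding cg_def by blast
  then have "- (-1 - 1) \<in> P" by (rule P_uminus)
  then show False using two_notin_P by simp
qed

lemma fourth_root_O8: "z ^ 4 = 1 \<Longrightarrow> z \<in> O8"
  by (drule fourth_root_cases) (elim disjE; simp)

lemma fourth_root_notin_P: "z ^ 4 = 1 \<Longrightarrow> z \<notin> P"
  using P_mult_left[of z "z ^ 3"] fourth_root_O8[of z] one_notin_P
  by (auto simp flip: power_Suc2)

text \<open>
  The quotient \<open>u\<close> of the two roots of unity satisfies \<open>u \<approx> 1\<close>. If it were \<open>-1\<close> or \<open>\<plusminus>\<i>\<close>, then \<open>u\<close> or \<open>u ^ 2\<close>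
  would give \<open>-1 \<approx> 1\<close>, contradicting that \<open>p\<close> does not divide 2.
\<close>

lemma fourth_roots_distinct:
  assumes "z ^ 4 = 1" "w ^ 4 = 1" "z \<approx> w"
  shows "z = w"
proof -
  define u where "u = z * w ^ 3"
  have w: "w \<in> O8" using assms(2) by (rule fourth_root_O8)
  have "u \<approx> w * w ^ 3" unfolding u_def using assms(3) w by (intro cg_mult) auto
  also have "w * w ^ 3 = 1" using assms(2) by (simp flip: power_Suc)
  finally have u1: "u \<approx> 1" .
  then have u2: "u ^ 2 \<approx> 1" using cg_power[OF u1, of 2] by simp
  have "u ^ 4 = z ^ 4 * (w ^ 4) ^ 3" by (simp add: u_def power_mult_distrib flip: power_mult)
  then have "u ^ 4 = 1" using assms by simp
  then have "u = 1 \<or> u = -1 \<or> u = \<i> \<or> u = - \<i>" by (rule fourth_root_cases)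
  then have "u = 1" using u1 u2 neg_1_not_cg_1 by (elim disjE) simp_all
  moreover have "u * w = z * w ^ 4" by (simp add: u_def power4_eq_xxxx power3_eq_cube)
  ultimately show ?thesis using assms(2) by simp
qed

text \<open>
  By \<open>fermat\<close> the power \<open>y\<close> satisfies \<open>y ^ n \<approx> 1\<close>; factor \<open>y ^ n - 1\<close> into linear factors over \<open>O8\<close> and
  use that \<open>p\<close> is prime.
\<close>

lemma ex_root_of_unity:
  assumes "x \<in> O8" "x \<notin> P" "n = 2 \<or> n = 4"
  shows "\<exists>\<zeta>. \<zeta> ^ n = 1 \<and> x ^ ((abs_norm p - 1) div n) \<approx> \<zeta>"
proof -
  define y where "y = x ^ ((abs_norm p - 1) div n)"
  have yO: "y \<in> O8" using assms by (simp add: y_def)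
  have "n dvd abs_norm p - 1" using norm_mod_4 assms(3) by presburger
  then have "y ^ n = x ^ (abs_norm p - 1)" by (simp add: y_def flip: power_mult)
  then have yn: "y ^ n - 1 \<in> P" using fermat[OF assms(1,2)] by (simp add: cg_def)
  have cg: "y \<approx> z" if "y - z \<in> P" "z \<in> O8" for z using that yO by (simp add: cg_def)
  show ?thesis unfolding y_def[symmetric] using assms(3)
  proof
    assume n: "n = 2"
    have "(y - 1) * (y - - 1) = y ^ n - 1" by (simp add: n power2_eq_square algebra_simps)
    then have "y - 1 \<in> P \<or> y - - 1 \<in> P" using yn yO P_prime[of "y - 1" "y - - 1"] by simp
    then show "\<exists>\<zeta>. \<zeta> ^ n = 1 \<and> y \<approx> \<zeta>"
    proof
      assume "y - 1 \<in> P"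
      then show ?thesis by (intro exI[of _ 1]) (simp add: cg)
    next
      assume "y - - 1 \<in> P"
      then show ?thesis by (intro exI[of _ "-1"]) (simp add: cg n)
    qed
  next
    assume n: "n = 4"
    have "(y - 1) * ((y - - 1) * ((y - \<i>) * (y - - \<i>))) = y ^ n - 1"
      by (simp add: n power4_eq_xxxx algebra_simps)
    then have "(y - 1) * ((y - - 1) * ((y - \<i>) * (y - - \<i>))) \<in> P" using yn by simp
    moreover have o: "y - 1 \<in> O8" "y - - 1 \<in> O8" "y - \<i> \<in> O8" "y - - \<i> \<in> O8"
      "(y - \<i>) * (y - - \<i>) \<in> O8" "(y - - 1) * ((y - \<i>) * (y - - \<i>)) \<in> O8"
      using yO by simp_all
    ultimately have "y - 1 \<in> P \<or> y - - 1 \<in> P \<or> y - \<i> \<in> P \<or> y - - \<i> \<in> P"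
      using P_prime[of "y - 1" "(y - - 1) * ((y - \<i>) * (y - - \<i>))"]
        P_prime[of "y - - 1" "(y - \<i>) * (y - - \<i>)"] P_prime[of "y - \<i>" "y - - \<i>"] o
      by blast
    then obtain z where "y - z \<in> P" "z = 1 \<or> z = -1 \<or> z = \<i> \<or> z = - \<i>" by blast
    moreover from this(2) have "z ^ 4 = 1" by (elim disjE) (simp_all add: power4_eq_xxxx)
    ultimately show "\<exists>\<zeta>. \<zeta> ^ n = 1 \<and> y \<approx> \<zeta>" using cg[of z] fourth_root_O8 n by blast
  qed
qed

lemma pow_n_imp_pow_4: "n = 2 \<or> n = 4 \<Longrightarrow> z ^ n = 1 \<Longrightarrow> (z::complex) ^ 4 = 1"
  by (elim disjE) (simp_all add: power4_eq_xxxx power2_eq_square)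

lemma symbol_eqI:
  assumes "x \<in> O8" "x \<notin> P" "n = 2 \<or> n = 4" "\<zeta> ^ n = 1" "x ^ ((abs_norm p - 1) div n) \<approx> \<zeta>"
  shows "\<chi> n x = \<zeta>"
proof -
  have "(THE \<zeta>. \<zeta> \<in> O8 \<and> \<zeta> ^ n = 1 \<and> x ^ ((abs_norm p - 1) div n) - \<zeta> \<in> P) = \<zeta>"
  proof (rule the_equality)
    show "\<zeta> \<in> O8 \<and> \<zeta> ^ n = 1 \<and> x ^ ((abs_norm p - 1) div n) - \<zeta> \<in> P"
      using assms by (simp add: cg_def)
    fix \<xi> assume *: "\<xi> \<in> O8 \<and> \<xi> ^ n = 1 \<and> x ^ ((abs_norm p - 1) div n) - \<xi> \<in> P"
    then have "x ^ ((abs_norm p - 1) div n) \<approx> \<xi>" using assms(1) by (simp add: cg_def)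
    then have c: "\<xi> \<approx> \<zeta>" using assms(5) cg_sym cg_trans by blast
    have "\<xi> ^ 4 = 1" using pow_n_imp_pow_4[OF assms(3)] * by simp
    have "\<zeta> ^ 4 = 1" using pow_n_imp_pow_4[OF assms(3,4)] .
    show "\<xi> = \<zeta>" by (rule fourth_roots_distinct) fact+
  qed
  then show ?thesis using assms(2) by (simp add: prime_residue_symbol_def)
qed

lemma symbol_props:
  assumes "x \<in> O8" "x \<notin> P" "n = 2 \<or> n = 4"
  shows symbol_power: "\<chi> n x ^ n = 1" and symbol_cg: "x ^ ((abs_norm p - 1) div n) \<approx> \<chi> n x"
proof -
  obtain \<zeta> where z: "\<zeta> ^ n = 1" "x ^ ((abs_norm p - 1) div n) \<approx> \<zeta>"
    using ex_root_of_unity[OF assms] by blast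
  then have "\<chi> n x = \<zeta>" by (rule symbol_eqI[OF assms])
  then show "\<chi> n x ^ n = 1" "x ^ ((abs_norm p - 1) div n) \<approx> \<chi> n x" using z by simp_all
qed

lemma symbol_P: "x \<in> P \<Longrightarrow> \<chi> n x = 0"
  by (simp add: prime_residue_symbol_def)

lemma symbol_mult:
  assumes "x \<in> O8" "y \<in> O8" "n = 2 \<or> n = 4"
  shows "\<chi> n (x * y) = \<chi> n x * \<chi> n y"
proof (cases "x \<in> P \<or> y \<in> P")
  case True
  then have "x * y \<in> P" using P_prime assms by simp
  then show ?thesis using True by (auto simp: symbol_P)
next
  case False
  then have xy: "x \<notin> P" "y \<notin> P" by auto
  have "x ^ ((abs_norm p - 1) div n) * y ^ ((abs_norm p - 1) div n) \<approx> \<chi> n x * \<chi> n y"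
    using xy assms by (intro cg_mult symbol_cg)
  then show ?thesis using xy assms P_prime symbol_power
    by - (rule symbol_eqI, simp_all add: power_mult_distrib)
qed

lemma symbol_cong:
  assumes "x \<approx> y" "n = 2 \<or> n = 4"
  shows "\<chi> n x = \<chi> n y"
proof (cases "x \<in> P")
  case True
  then have "y \<in> P" using cg_P assms by blast
  then show ?thesis using True by (simp add: symbol_P)
next
  case False
  then have y: "x \<in> O8" "y \<in> O8" "y \<notin> P" using assms(1) cg_P cg_O8 by blast+
  have "x ^ ((abs_norm p - 1) div n) \<approx> y ^ ((abs_norm p - 1) div n)" by (rule cg_power[OF assms(1)])
  also have "\<dots> \<approx> \<chi> n y" using y assms by (intro symbol_cg)
  finally show ?thesis using y False assms(2) symbol_power by - (rule symbol_eqI, simp_all)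
qed

lemma symbol_1: "n = 2 \<or> n = 4 \<Longrightarrow> \<chi> n 1 = 1"
  by (rule symbol_eqI) (auto simp: one_notin_P)

lemma symbol_2_cases: "x \<in> O8 \<Longrightarrow> x \<notin> P \<Longrightarrow> \<chi> 2 x = 1 \<or> \<chi> 2 x = -1"
  using symbol_power[of x 2] by (simp add: power2_eq_1_iff)

text \<open>
  Both follow from \<open>2 * ((N - 1) div 4) = (N - 1) div 2\<close> for the norm \<open>N\<close>, which is 1 modulo 4.
\<close>

lemma symbol_4_square:
  assumes "x \<in> O8" "x \<notin> P"
  shows "\<chi> 4 (x ^ 2) = \<chi> 2 x" and "\<chi> 4 x ^ 2 = \<chi> 2 x"
proof -
  have eq: "2 * ((abs_norm p - 1) div 4) = (abs_norm p - 1) div 2" using norm_mod_4 by presburger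
  have c: "x ^ ((abs_norm p - 1) div 2) \<approx> \<chi> 2 x" using assms by (intro symbol_cg) blast+
  have "(x ^ 2) ^ ((abs_norm p - 1) div 4) \<approx> \<chi> 2 x"
    unfolding power_mult[symmetric] eq by (rule c)
  moreover have "x ^ 2 \<notin> P" using P_power assms by blast
  ultimately show "\<chi> 4 (x ^ 2) = \<chi> 2 x"
    using assms pow_n_imp_pow_4[of 2 "\<chi> 2 x"] symbol_power[of x 2] by - (rule symbol_eqI, simp_all)
  have "(x ^ ((abs_norm p - 1) div 4)) ^ 2 \<approx> \<chi> 4 x ^ 2"
    using assms by (intro cg_power symbol_cg) auto
  moreover have "(x ^ ((abs_norm p - 1) div 4)) ^ 2 = x ^ ((abs_norm p - 1) div 2)"
    unfolding eq[symmetric] power_mult by (metis mult.commute power_mult)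
  ultimately show "\<chi> 4 x ^ 2 = \<chi> 2 x"
    using symbol_power[of x 4] assms by - (rule symbol_eqI[symmetric], simp_all flip: power_mult)
qed

lemma symbol_2_square: "x \<in> O8 \<Longrightarrow> x \<notin> P \<Longrightarrow> \<chi> 2 (x ^ 2) = 1"
  using symbol_mult[of x x 2] symbol_power[of x 2] by (simp add: power2_eq_square)

lemma symbol_inv:
  assumes "x \<in> O8" "x \<notin> P" "n = 2 \<or> n = 4"
  shows "\<chi> n x * \<chi> n (inv_mod p x) = 1"
  using symbol_mult[of x "inv_mod p x" n] symbol_cong[OF inv_cg, of x n] symbol_1[of n]
    inv_O8[of x] assms by simp

text \<open>
  Already in \<open>O8\<close>, \<open>-1\<close> is the square of \<open>\<i>\<close>.
\<close>

lemma symbol_2_minus: "x \<in> O8 \<Longrightarrow> \<chi> 2 (- x) = \<chi> 2 x"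
proof -
  assume x: "x \<in> O8"
  have "\<i> \<notin> P" by (rule fourth_root_notin_P) (simp add: power4_eq_xxxx)
  then have "\<chi> 2 (-1) = 1" using symbol_2_square[of \<i>] by simp
  then show ?thesis using symbol_mult[of "-1" x 2] x by simp
qed

text \<open>
  Write \<open>u \<approx> g ^ k\<close> with a primitive root \<open>g\<close>. If the symbol of \<open>g\<close> were 1, the powers of \<open>g\<close> would fill
  only \<open>m = (N - 1) div 2\<close> classes instead of \<open>N - 1\<close>. So it is \<open>-1\<close>, hence \<open>k\<close> is even.
\<close>

lemma euler_criterion:
  assumes "u \<in> O8" "\<chi> 2 u = 1"
  shows "\<exists>y\<in>O8. u \<approx> y ^ 2"
proof -
  define m where "m = (abs_norm p - 1) div 2"
  have m: "abs_norm p - 1 = 2 * m" "m > 0"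
    using norm_pos norm_mod_4 unfolding m_def by presburger+
  have uP: "u \<notin> P" using assms(2) symbol_P by force
  obtain g where g: "g \<in> O8" "g \<notin> P" and gen: "\<And>x. x \<in> O8 \<Longrightarrow> x \<notin> P \<Longrightarrow> \<exists>k. x \<approx> g ^ k"
    using primitive_root by blast
  obtain k where k: "u \<approx> g ^ k" using gen assms(1) uP by blast
  have pow: "\<chi> 2 (g ^ j) = \<chi> 2 g ^ j" for j
    using g by (induction j) (simp_all add: symbol_1 symbol_mult)
  have "\<chi> 2 g \<noteq> 1"
  proof
    assume "\<chi> 2 g = 1"
    then have gm: "g ^ m \<approx> 1" using symbol_cg[of g 2] g by (simp add: m_def)
    have "U \<subseteq> (\<lambda>j. red (g ^ j)) ` {..<m}"
    proof
      fix x assume x: "x \<in> U"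
      then obtain j where "x \<approx> g ^ j" using gen U_O8 by blast
      also have "g ^ j = (g ^ m) ^ (j div m) * g ^ (j mod m)"
        by (simp flip: power_mult power_add)
      also have "\<dots> \<approx> 1 ^ (j div m) * g ^ (j mod m)"
        using g by (intro cg_mult cg_power gm) simp
      finally have "x \<approx> g ^ (j mod m)" by simp
      then have "red x = red (g ^ (j mod m))" using red_eq_iff cg_O8 by blast
      then have "x = red (g ^ (j mod m))" using red_R x by (simp add: U_iff)
      then show "x \<in> (\<lambda>j. red (g ^ j)) ` {..<m}" using m(2) by simp
    qed
    then have "card U \<le> card {..<m}" by (rule surj_card_le[rotated]) simp
    then show False using m by (simp add: card_U)
  qed
  then have "\<chi> 2 g = -1" using symbol_2_cases g by blast
  then have "\<chi> 2 u = (-1) ^ k" using symbol_cong[OF k] pow by simp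
  then have "even k" using assms(2) by (cases "even k") auto
  then obtain j where "k = 2 * j" by blast
  then have "u \<approx> (g ^ j) ^ 2" using k by (simp add: mult.commute flip: power_mult)
  then show ?thesis using g by blast
qed

section \<open>Counting square roots\<close>

lemma square_roots:
  assumes "y \<in> O8" "u \<approx> y ^ 2"
  shows "{x. x \<in> R \<and> x ^ 2 \<approx> u} = {red y, red (- y)}"
proof -
  have "x ^ 2 \<approx> u \<longleftrightarrow> x = red y \<or> x = red (- y)" if x: "x \<in> R" for x
  proof -
    have xO: "x \<in> O8" using x R_subset_O8 by blast
    have "x ^ 2 \<approx> u \<longleftrightarrow> x ^ 2 \<approx> y ^ 2" using assms(2) cg_sym cg_trans by blast
    also have "\<dots> \<longleftrightarrow> (x - y) * (x - - y) \<in> P"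
      using xO assms(1) by (simp add: cg_iff_diff power2_eq_square algebra_simps)
    also have "\<dots> \<longleftrightarrow> x - y \<in> P \<or> x - - y \<in> P" using xO assms(1) by (intro P_prime) simp_all
    also have "\<dots> \<longleftrightarrow> x \<approx> y \<or> x \<approx> - y" using xO assms(1) by (simp add: cg_iff_diff)
    also have "\<dots> \<longleftrightarrow> x = red y \<or> x = red (- y)"
      using xO assms(1) red_eq_iff[of x y] red_eq_iff[of x "- y"] red_R[OF x] by simp
    finally show ?thesis .
  qed
  moreover have "red y \<in> R" "red (- y) \<in> R" using assms(1) red_in_R by simp_all
  ultimately show ?thesis by blast
qed

lemma red_uminus_neq:
  assumes "y \<in> O8" "y \<notin> P"
  shows "red y \<noteq> red (- y)"
proof
  assume "red y = red (- y)"
  then have "y \<approx> - y" using red_eq_iff assms by simp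
  then have "2 * y \<in> P" by (simp add: cg_def)
  then show False using P_prime[of 2 y] two_notin_P assms by simp
qed

text \<open>
  A unit that is a square has the two roots \<open>\<plusminus>y\<close>, distinct because \<open>p\<close> does not divide 2, and by
  \<open>euler_criterion\<close> the units with symbol 1 are squares.
\<close>

lemma card_square_roots:
  assumes "u \<in> O8"
  shows "of_nat (card {x. x \<in> R \<and> x ^ 2 \<approx> u}) = 1 + \<chi> 2 u"
proof (cases "u \<in> P")
  case True
  then have "u \<approx> 0 ^ 2" by (simp add: cg_0_iff)
  then have "{x. x \<in> R \<and> x ^ 2 \<approx> u} = {red 0}" using square_roots[of 0 u] by simp
  then show ?thesis using True by (simp add: symbol_P)
next
  case False
  show ?thesis
  proof (cases "\<chi> 2 u = 1")
    case True
    then obtain y where y: "y \<in> O8" "u \<approx> y ^ 2" using euler_criterion assms by blast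
    have "y \<notin> P"
    proof
      assume "y \<in> P"
      then have "y ^ 2 \<in> P" using P_mult_left[of y y] y by (simp add: power2_eq_square)
      then show False using cg_P[OF y(2)] False by simp
    qed
    then show ?thesis using square_roots[OF y] red_uminus_neq[OF y(1)] True by simp
  next
    case n: False
    have "\<not> x ^ 2 \<approx> u" if "x \<in> R" for x
    proof
      assume c: "x ^ 2 \<approx> u"
      have x: "x \<in> O8" using R_subset_O8 that by simp
      then have "x \<notin> P" using False cg_P[OF c] P_mult_left[of x x] by (auto simp: power2_eq_square)
      then have "\<chi> 2 u = 1" using symbol_2_square[OF x] symbol_cong[OF c, of 2] by simp
      then show False using n by simp
    qed
    then have "{x. x \<in> R \<and> x ^ 2 \<approx> u} = {}" by blast
    moreover have "\<chi> 2 u = -1" using n symbol_2_cases assms False by blast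
    ultimately show ?thesis by (simp only:) simp
  qed
qed

lemma sum_squares:
  fixes F :: "complex \<Rightarrow> complex"
  assumes "\<And>x y. x \<approx> y \<Longrightarrow> F x = F y"
  shows "(\<Sum>x\<in>R. F (x ^ 2)) = (\<Sum>u\<in>R. F u) + (\<Sum>u\<in>R. \<chi> 2 u * F u)"
proof -
  have "(\<Sum>x\<in>R. F (x ^ 2)) = (\<Sum>u\<in>R. \<Sum>x | x \<in> R \<and> x ^ 2 \<approx> u. F (x ^ 2))"
    by (rule sum_fibres) (auto intro: R_subset_O8)
  also have "\<dots> = (\<Sum>u\<in>R. \<Sum>x | x \<in> R \<and> x ^ 2 \<approx> u. F u)"
    using assms by (intro sum.cong refl) blast
  also have "\<dots> = (\<Sum>u\<in>R. (1 + \<chi> 2 u) * F u)"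
    by (intro sum.cong refl) (simp add: card_square_roots R_subset_O8)
  finally show ?thesis by (simp add: distrib_right sum.distrib)
qed

text \<open>
  If \<open>x \<approx> z ^ 2\<close>, the roots are \<open>\<plusminus>z\<close>, and all of \<open>\<chi> 2 z\<close>, \<open>\<chi> 2 (- z)\<close>, \<open>\<chi> 4 x\<close>, \<open>\<chi> 4 (1 / x)\<close> are equal.
  If \<open>x\<close> is not a square, then \<open>\<chi> 4 x ^ 2 = -1\<close>, so \<open>\<chi> 4 (1 / x)\<close>, the inverse of \<open>\<chi> 4 x\<close>, is its
  negative.
\<close>

lemma sum_over_square_roots:
  assumes "x \<in> U"
  shows "(\<Sum>y | y \<in> U \<and> y ^ 2 \<approx> x. \<chi> 2 y) = \<chi> 4 x + \<chi> 4 (inv_mod p x)"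
proof (cases "\<chi> 2 x = 1")
  case True
  have x: "x \<in> O8" "x \<notin> P" using assms U_O8 by blast+
  obtain z where z: "z \<in> O8" "x \<approx> z ^ 2" using euler_criterion x True by blast
  have zP: "z \<notin> P" using cg_P[OF z(2)] x(2) P_mult_left[of z z] z(1) by (auto simp: power2_eq_square)
  have "red z \<in> U" "red (- z) \<in> U"
    using red_in_R z(1) cg_P[OF red_cg[of z]] cg_P[OF red_cg[of "- z"]] zP P_uminus[of "- z"]
    by (auto simp: U_iff)
  then have "{y. y \<in> U \<and> y ^ 2 \<approx> x} = {red z, red (- z)}"
    using square_roots[OF z] by (auto simp: U_iff)
  then have "(\<Sum>y | y \<in> U \<and> y ^ 2 \<approx> x. \<chi> 2 y) = \<chi> 2 (red z) + \<chi> 2 (red (- z))"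
    using red_uminus_neq[OF z(1) zP] by simp
  also have "\<dots> = 2 * \<chi> 2 z"
    using symbol_cong[OF red_cg[of z], of 2] symbol_cong[OF red_cg[of "- z"], of 2]
      symbol_2_minus[of z] z(1) by simp
  finally have 1: "(\<Sum>y | y \<in> U \<and> y ^ 2 \<approx> x. \<chi> 2 y) = 2 * \<chi> 2 z" .
  have 2: "\<chi> 4 x = \<chi> 2 z" using symbol_cong[OF z(2), of 4] symbol_4_square(1)[OF z(1) zP] by simp
  have "\<chi> 4 x * \<chi> 4 (inv_mod p x) = 1" using symbol_inv x by blast
  then have "\<chi> 4 (inv_mod p x) = \<chi> 2 z"
    using symbol_2_cases[OF z(1) zP] 2 by (auto simp: minus_equation_iff[of _ 1])
  then show ?thesis using 1 2 by simp
next
  case False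
  have x: "x \<in> O8" "x \<notin> P" using assms U_O8 by blast+
  have "\<chi> 2 x = -1" using False x symbol_2_cases by blast
  then have sq: "\<chi> 4 x ^ 2 = -1" using symbol_4_square(2)[OF x] by simp
  have inv: "\<chi> 4 x * \<chi> 4 (inv_mod p x) = 1" using symbol_inv x by blast
  have "\<chi> 4 x * (\<chi> 4 x + \<chi> 4 (inv_mod p x)) = 0"
    using sq inv by (simp add: distrib_left power2_eq_square)
  moreover have "\<chi> 4 x \<noteq> 0" using inv by auto
  ultimately have 1: "\<chi> 4 x + \<chi> 4 (inv_mod p x) = 0" by simp
  have "\<not> y ^ 2 \<approx> x" if "y \<in> U" for y
    using symbol_2_square[of y] symbol_cong[of "y ^ 2" x 2] False U_O8 that by auto
  then have "{y. y \<in> U \<and> y ^ 2 \<approx> x} = {}" by blast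
  then show ?thesis using 1 by (simp only: sum.empty)
qed

lemma inv_inv: "x \<in> O8 \<Longrightarrow> x \<notin> P \<Longrightarrow> inv_mod p (inv_mod p x) \<approx> x"
  using inv_unique[of "inv_mod p x" x] inv_mod_props[of x] by (simp add: mult.commute)

text \<open>
  Collecting the \<open>y\<close> with the same square \<open>x\<close> gives the sum of \<open>(\<chi> 4 x + \<chi> 4 (1 / x)) * G x\<close> by
  \<open>sum_over_square_roots\<close>, and the symmetry of \<open>G\<close> identifies its two halves.
\<close>

lemma quartic_sum:
  fixes G :: "complex \<Rightarrow> complex"
  assumes G: "\<And>x y. x \<approx> y \<Longrightarrow> x \<notin> P \<Longrightarrow> G x = G y"
    and sym: "\<And>x. x \<in> O8 \<Longrightarrow> x \<notin> P \<Longrightarrow> G (inv_mod p x) = G x"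
  shows "(\<Sum>y\<in>U. \<chi> 2 y * G (y ^ 2)) = 2 * (\<Sum>x\<in>U. \<chi> 4 x * G x)"
proof -
  have "(\<Sum>y\<in>U. \<chi> 2 y * G (y ^ 2)) = (\<Sum>x\<in>R. \<Sum>y | y \<in> U \<and> y ^ 2 \<approx> x. \<chi> 2 y * G (y ^ 2))"
    by (rule sum_fibres) (auto intro: U_O8)
  also have "\<dots> = (\<Sum>x\<in>U. \<Sum>y | y \<in> U \<and> y ^ 2 \<approx> x. \<chi> 2 y * G (y ^ 2))"
  proof (rule sum.mono_neutral_right)
    show "\<forall>x\<in>R - U. (\<Sum>y | y \<in> U \<and> y ^ 2 \<approx> x. \<chi> 2 y * G (y ^ 2)) = 0"
    proof
      fix x assume "x \<in> R - U"
      then have "x \<in> P" by (auto simp: U_iff)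
      then have "{y. y \<in> U \<and> y ^ 2 \<approx> x} = {}" using cg_P P_power U_O8 by blast
      then show "(\<Sum>y | y \<in> U \<and> y ^ 2 \<approx> x. \<chi> 2 y * G (y ^ 2)) = 0" by (simp only: sum.empty)
    qed
  qed (auto simp: U_iff)
  also have "\<dots> = (\<Sum>x\<in>U. (\<Sum>y | y \<in> U \<and> y ^ 2 \<approx> x. \<chi> 2 y) * G x)"
  proof (intro sum.cong refl)
    fix x assume "x \<in> U"
    have "G (y ^ 2) = G x" if "y \<in> U" "y ^ 2 \<approx> x" for y
      using G[OF that(2)] P_power U_O8[OF that(1)] by blast
    then show "(\<Sum>y | y \<in> U \<and> y ^ 2 \<approx> x. \<chi> 2 y * G (y ^ 2)) = (\<Sum>y | y \<in> U \<and> y ^ 2 \<approx> x. \<chi> 2 y) * G x"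
      unfolding sum_distrib_right by (intro sum.cong refl) simp
  qed
  also have "\<dots> = (\<Sum>x\<in>U. \<chi> 4 x * G x + \<chi> 4 (inv_mod p x) * G x)"
    by (intro sum.cong refl) (simp add: sum_over_square_roots distrib_right)
  also have "\<dots> = (\<Sum>x\<in>U. \<chi> 4 x * G x) + (\<Sum>x\<in>U. \<chi> 4 (inv_mod p x) * G (inv_mod p x))"
    by (simp add: sum.distrib sym U_O8)
  also have "(\<Sum>x\<in>U. \<chi> 4 (inv_mod p x) * G (inv_mod p x)) = (\<Sum>x\<in>U. \<chi> 4 x * G x)"
    unfolding U_def
  proof (rule sum_reindex[where \<psi> = "inv_mod p"])
    show "\<chi> 4 x * G x = \<chi> 4 y * G y" if "x \<approx> y" "x \<notin> P" for x y
      using that G[OF that] symbol_cong[of x y 4] by simp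
    show "y \<notin> P" if "x \<approx> y" "x \<notin> P" for x y using that cg_P by blast
  qed (auto intro: inv_mod_cong inv_inv simp: inv_notin_P dest: cg_P)
  finally show ?thesis by simp
qed

section \<open>The quartic and the quadratic sum\<close>

text \<open>
  In the next lemmas \<open>y\<close> and \<open>s\<close> are related by \<open>s = (y - 1) ^ 2 / (4 y)\<close>, which is stated without a
  denominator. The identity holds since \<open>4 s + 4 = (y + 1) ^ 2 / y\<close>, so that
  \<open>16 (s ^ 2 + s) = 4 s (4 s + 4) = (y - 1 / y) ^ 2\<close>.
\<close>

lemma fibre_cg:
  assumes "y \<in> O8" "y \<notin> P" "s \<in> O8" "(y - 1) ^ 2 \<approx> 4 * s * y"
  shows "y ^ 2 + inv_mod p (y ^ 2) - 2 \<approx> 16 * (s ^ 2 + s)"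
proof -
  have y2: "y ^ 2 \<in> O8" "y ^ 2 \<notin> P" using assms P_power by auto
  note i = inv_O8[OF y2] inv_cg[OF y2]
  have "y ^ 2 * (y ^ 2 + inv_mod p (y ^ 2) - 2) = y ^ 4 - 2 * y ^ 2 + y ^ 2 * inv_mod p (y ^ 2)"
    by (simp add: algebra_simps power4_eq_xxxx power2_eq_square)
  also have "\<dots> \<approx> y ^ 4 - 2 * y ^ 2 + 1" using assms(1) i(2) by (intro cg_add) simp_all
  also have "y ^ 4 - 2 * y ^ 2 + 1 = (y - 1) ^ 2 * ((y - 1) ^ 2 + 4 * y)"
    by (simp add: algebra_simps power4_eq_xxxx power2_eq_square)
  also have "\<dots> \<approx> (4 * s * y) * (4 * s * y + 4 * y)"
    using assms by (intro cg_mult cg_add) simp_all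
  also have "(4 * s * y) * (4 * s * y + 4 * y) = y ^ 2 * (16 * (s ^ 2 + s))"
    by (simp add: algebra_simps power2_eq_square)
  finally have *: "y ^ 2 * (y ^ 2 + inv_mod p (y ^ 2) - 2) \<approx> y ^ 2 * (16 * (s ^ 2 + s))" .
  show ?thesis by (rule cg_cancel[OF y2 _ _ *]) (use i(1) assms(1,3) in simp_all)
qed

lemma four_notin_P: "4 \<notin> P"
  using P_prime[of 2 2] two_notin_P by simp

text \<open>
  Completing the square: \<open>y = 1 + 2 s + 2 w\<close> turns the quadratic equation for \<open>y\<close> into
  \<open>w ^ 2 = s ^ 2 + s\<close>.
\<close>

lemma card_fibre:
  assumes "s \<in> O8"
  shows "of_nat (card {y. y \<in> U \<and> (y - 1) ^ 2 \<approx> 4 * s * y}) = 1 + \<chi> 2 (s ^ 2 + s)"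
proof -
  define t where "t = inv_mod p 2"
  have t: "t \<in> O8" "2 * t \<approx> 1" using inv_mod_props[of 2] two_notin_P by (simp_all add: t_def)
  have "y \<notin> P" if "(y - 1) ^ 2 \<approx> 4 * s * y" "y \<in> O8" for y
  proof
    assume "y \<in> P"
    then have "4 * s * y \<in> P" using assms by (intro P_mult_left) simp_all
    then have "(y - 1) ^ 2 \<in> P" using cg_P[OF that(1)] by simp
    then have "y - 1 \<in> P" by (rule P_power[rotated]) (use that in simp)
    then show False using P_diff[OF \<open>y \<in> P\<close>, of "y - 1"] one_notin_P by simp
  qed
  then have eq: "{y. y \<in> U \<and> (y - 1) ^ 2 \<approx> 4 * s * y} = {y. y \<in> R \<and> (y - 1) ^ 2 \<approx> 4 * s * y}"
    using R_subset_O8 by (auto simp: U_iff)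
  have "of_nat (card {y. y \<in> U \<and> (y - 1) ^ 2 \<approx> 4 * s * y})
      = (\<Sum>y | y \<in> R \<and> (y - 1) ^ 2 \<approx> 4 * s * y. 1 :: complex)"
    unfolding eq by simp
  also have "\<dots> = (\<Sum>w | w \<in> R \<and> w ^ 2 \<approx> s ^ 2 + s. 1 :: complex)"
  proof (rule sum_reindex[where \<phi> = "\<lambda>y. t * (y - 1 - 2 * s)" and \<psi> = "\<lambda>w. 1 + 2 * s + 2 * w"])
    fix x y assume xy: "x \<approx> y"
    note xyO = cg_O8[OF xy]
    show "t * (x - 1 - 2 * s) \<approx> t * (y - 1 - 2 * s)"
      using xy t assms by (intro cg_mult cg_diff) simp_all
    show "1 + 2 * s + 2 * x \<approx> 1 + 2 * s + 2 * y"
      using xy assms by (intro cg_mult cg_add) simp_all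
    show "(y - 1) ^ 2 \<approx> 4 * s * y" if "(x - 1) ^ 2 \<approx> 4 * s * x"
    proof -
      have "(y - 1) ^ 2 \<approx> (x - 1) ^ 2" using cg_sym[OF xy] by (intro cg_power cg_diff) simp_all
      also note that
      also have "4 * s * x \<approx> 4 * s * y" using xy assms by (intro cg_mult) simp_all
      finally show ?thesis .
    qed
    show "y ^ 2 \<approx> s ^ 2 + s" if "x ^ 2 \<approx> s ^ 2 + s"
      using cg_power[OF cg_sym[OF xy], of 2] that by (rule cg_trans)
  next
    fix x assume x: "x \<in> O8"
    have "1 + 2 * s + 2 * (t * (x - 1 - 2 * s)) = 1 + 2 * s + (2 * t) * (x - 1 - 2 * s)" by simp
    also have "\<dots> \<approx> 1 + 2 * s + 1 * (x - 1 - 2 * s)"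
      using x t assms by (intro cg_add cg_mult) simp_all
    finally show "1 + 2 * s + 2 * (t * (x - 1 - 2 * s)) \<approx> x" by simp
    have "t * (1 + 2 * s + 2 * x - 1 - 2 * s) = (2 * t) * x" by simp
    also have "\<dots> \<approx> 1 * x" using x t by (intro cg_mult) simp_all
    finally show "t * (1 + 2 * s + 2 * x - 1 - 2 * s) \<approx> x" by simp
  next
    fix x assume x: "x \<in> O8" and *: "(x - 1) ^ 2 \<approx> 4 * s * x"
    have "4 * (t * (x - 1 - 2 * s)) ^ 2 = ((2 * t) * (x - 1 - 2 * s)) ^ 2"
      by (simp add: power_mult_distrib)
    also have "\<dots> \<approx> (1 * (x - 1 - 2 * s)) ^ 2"
      using x t assms by (intro cg_power cg_mult) simp_all
    also have "(1 * (x - 1 - 2 * s)) ^ 2 = (x - 1) ^ 2 + (4 * s ^ 2 - 4 * s * (x - 1))"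
      by (simp add: power2_eq_square algebra_simps)
    also have "\<dots> \<approx> 4 * s * x + (4 * s ^ 2 - 4 * s * (x - 1))"
      using x assms * by (intro cg_add) simp_all
    also have "4 * s * x + (4 * s ^ 2 - 4 * s * (x - 1)) = 4 * (s ^ 2 + s)"
      by (simp add: power2_eq_square algebra_simps)
    finally have **: "4 * (t * (x - 1 - 2 * s)) ^ 2 \<approx> 4 * (s ^ 2 + s)" .
    show "(t * (x - 1 - 2 * s)) ^ 2 \<approx> s ^ 2 + s"
      by (rule cg_cancel[OF O8_numeral four_notin_P _ _ **]) (use x t assms in simp_all)
  next
    fix x assume x: "x \<in> O8" and *: "x ^ 2 \<approx> s ^ 2 + s"
    have "(1 + 2 * s + 2 * x - 1) ^ 2 = 4 * s ^ 2 + 8 * s * x + 4 * x ^ 2"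
      by (simp add: power2_eq_square algebra_simps)
    also have "\<dots> \<approx> 4 * s ^ 2 + 8 * s * x + 4 * (s ^ 2 + s)"
      using x assms * by (intro cg_add cg_mult) simp_all
    also have "4 * s ^ 2 + 8 * s * x + 4 * (s ^ 2 + s) = 4 * s * (1 + 2 * s + 2 * x)"
      by (simp add: power2_eq_square algebra_simps)
    finally show "(1 + 2 * s + 2 * x - 1) ^ 2 \<approx> 4 * s * (1 + 2 * s + 2 * x)" .
  qed simp
  also have "\<dots> = of_nat (card {w. w \<in> R \<and> w ^ 2 \<approx> s ^ 2 + s})" by simp
  also have "\<dots> = 1 + \<chi> 2 (s ^ 2 + s)" using assms by (intro card_square_roots) simp_all
  finally show ?thesis .
qed

text \<open>
  If \<open>s\<close> is a unit, then \<open>4 * s * y\<close> is congruent to a nonzero square, so \<open>s\<close> and \<open>y\<close> have the same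
  symbol. For \<open>s \<approx> 0\<close> the only solution is \<open>y \<approx> 1\<close>.
\<close>

lemma symbol_2_fibre:
  assumes "y \<in> O8" "y \<notin> P" "s \<in> O8" "(y - 1) ^ 2 \<approx> 4 * s * y"
  shows "\<chi> 2 y = (if s \<in> P then 1 else \<chi> 2 s)"
proof (cases "s \<in> P")
  case True
  then have "4 * s * y \<in> P" using P_mult_left[of s "4 * y"] assms(1) by (simp add: mult_ac)
  then have "(y - 1) ^ 2 \<in> P" using cg_P[OF assms(4)] by simp
  then have "y - 1 \<in> P" by (rule P_power[rotated]) (use assms in simp)
  then have "y \<approx> 1" using assms(1) by (simp add: cg_def)
  then show ?thesis using symbol_cong[of y 1 2] symbol_1[of 2] True by simp
next
  case False
  have "4 * s * y \<notin> P"
    using P_prime[of "4 * s" y] P_prime[of 4 s] four_notin_P False assms by simp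
  then have "(y - 1) ^ 2 \<notin> P" using cg_P[OF assms(4)] by simp
  then have "y - 1 \<notin> P" using P_mult_left[of "y - 1" "y - 1"] assms(1) by (auto simp: power2_eq_square)
  then have "1 = \<chi> 2 ((y - 1) ^ 2)" using symbol_2_square[of "y - 1"] assms(1) by simp
  also have "\<dots> = \<chi> 2 (4 * s * y)" by (rule symbol_cong[OF assms(4)]) simp
  also have "\<dots> = \<chi> 2 (2 ^ 2) * \<chi> 2 s * \<chi> 2 y"
    using assms by (simp add: symbol_mult)
  also have "\<chi> 2 (2 ^ 2) = 1" using symbol_2_square[of 2] two_notin_P by simp
  finally have "\<chi> 2 s * \<chi> 2 y = 1" by simp
  then show ?thesis using symbol_2_cases[of s] symbol_2_cases[of y] assms False by auto
qed

text \<open>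
  By \<open>card_fibre\<close> and \<open>symbol_2_fibre\<close> the class of \<open>s\<close> contributes \<open>\<chi> 2 s + \<chi> 2 (s + 1)\<close>. This includes
  \<open>s \<approx> 0\<close>, where the contribution is 1. The substitution \<open>s \<mapsto> - 1 - s\<close> maps \<open>s + 1\<close> to \<open>- s\<close>.
\<close>

lemma quadratic_twist_sum:
  fixes F :: "complex \<Rightarrow> complex"
  assumes F: "\<And>x y. x \<approx> y \<Longrightarrow> F x = F y"
  shows "(\<Sum>y\<in>U. \<chi> 2 y * F (y ^ 2 + inv_mod p (y ^ 2) - 2)) = 2 * (\<Sum>s\<in>R. \<chi> 2 s * F (16 * (s ^ 2 + s)))"
proof -
  define t where "t = inv_mod p 4"
  have t: "t \<in> O8" "4 * t \<approx> 1" using inv_mod_props[of 4] four_notin_P by (simp_all add: t_def)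
  have \<sigma>: "t * (y - 1) ^ 2 * inv_mod p y \<approx> s \<longleftrightarrow> (y - 1) ^ 2 \<approx> 4 * s * y"
    if y: "y \<in> U" and s: "s \<in> R" for y s
  proof -
    have yO: "y \<in> O8" "y \<notin> P" and sO: "s \<in> O8" using y s U_O8 R_subset_O8 by blast+
    note i = inv_O8[OF yO] inv_cg[OF yO]
    have "4 * y * (t * (y - 1) ^ 2 * inv_mod p y) = (4 * t) * (y * inv_mod p y) * (y - 1) ^ 2"
      by (simp add: mult_ac)
    also have "\<dots> \<approx> 1 * 1 * (y - 1) ^ 2" using yO t i by (intro cg_mult) simp_all
    finally have c: "4 * y * (t * (y - 1) ^ 2 * inv_mod p y) \<approx> (y - 1) ^ 2" by simp
    have 4: "4 * y \<in> O8" "4 * y \<notin> P" using yO P_prime[of 4 y] four_notin_P by simp_all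
    show ?thesis
    proof
      assume "t * (y - 1) ^ 2 * inv_mod p y \<approx> s"
      then have "4 * y * (t * (y - 1) ^ 2 * inv_mod p y) \<approx> 4 * y * s"
        using 4 yO by (intro cg_mult[of "4 * y" "4 * y"]) simp_all
      then have "(y - 1) ^ 2 \<approx> 4 * y * s" using cg_sym[OF c] cg_trans by blast
      then show "(y - 1) ^ 2 \<approx> 4 * s * y" by (simp add: mult_ac)
    next
      assume "(y - 1) ^ 2 \<approx> 4 * s * y"
      then have "4 * y * (t * (y - 1) ^ 2 * inv_mod p y) \<approx> 4 * s * y" using c cg_trans by blast
      also have "4 * s * y = 4 * y * s" by simp
      finally have *: "4 * y * (t * (y - 1) ^ 2 * inv_mod p y) \<approx> 4 * y * s" .
      show "t * (y - 1) ^ 2 * inv_mod p y \<approx> s"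
        by (rule cg_cancel[OF 4 _ sO *]) (use yO(1) t(1) i(1) in simp)
    qed
  qed
  define H where "H s = F (16 * (s ^ 2 + s))" for s
  have H: "H x = H y" if "x \<approx> y" for x y
    unfolding H_def using that by (intro F cg_mult cg_add cg_power) simp_all
  have "(\<Sum>y\<in>U. \<chi> 2 y * F (y ^ 2 + inv_mod p (y ^ 2) - 2)) =
      (\<Sum>s\<in>R. \<Sum>y | y \<in> U \<and> t * (y - 1) ^ 2 * inv_mod p y \<approx> s.
        \<chi> 2 y * F (y ^ 2 + inv_mod p (y ^ 2) - 2))"
    by (rule sum_fibres) (simp_all add: t U_O8 inv_O8)
  also have "\<dots> = (\<Sum>s\<in>R. \<Sum>y | y \<in> U \<and> (y - 1) ^ 2 \<approx> 4 * s * y. (if s \<in> P then 1 else \<chi> 2 s) * H s)"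
  proof (intro sum.cong refl)
    fix s assume s: "s \<in> R"
    then show "{y. y \<in> U \<and> t * (y - 1) ^ 2 * inv_mod p y \<approx> s} = {y. y \<in> U \<and> (y - 1) ^ 2 \<approx> 4 * s * y}"
      using \<sigma> by blast
    fix y assume "y \<in> {y. y \<in> U \<and> (y - 1) ^ 2 \<approx> 4 * s * y}"
    then have y: "y \<in> O8" "y \<notin> P" "s \<in> O8" "(y - 1) ^ 2 \<approx> 4 * s * y"
      using U_O8 R_subset_O8 s by blast+
    show "\<chi> 2 y * F (y ^ 2 + inv_mod p (y ^ 2) - 2) = (if s \<in> P then 1 else \<chi> 2 s) * H s"
      unfolding H_def symbol_2_fibre[OF y] F[OF fibre_cg[OF y]] ..
  qed
  also have "\<dots> = (\<Sum>s\<in>R. (1 + \<chi> 2 (s ^ 2 + s)) * ((if s \<in> P then 1 else \<chi> 2 s) * H s))"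
    by (intro sum.cong refl) (simp add: card_fibre R_subset_O8)
  also have "\<dots> = (\<Sum>s\<in>R. \<chi> 2 s * H s + \<chi> 2 (s + 1) * H s)"
  proof (intro sum.cong refl)
    fix s assume "s \<in> R"
    then have s: "s \<in> O8" using R_subset_O8 by blast
    have m: "\<chi> 2 (s ^ 2 + s) = \<chi> 2 s * \<chi> 2 (s + 1)"
      using symbol_mult[of s "s + 1" 2] s by (simp add: power2_eq_square algebra_simps)
    have "(1 + \<chi> 2 (s ^ 2 + s)) * (if s \<in> P then 1 else \<chi> 2 s) = \<chi> 2 s + \<chi> 2 (s + 1)"
    proof (cases "s \<in> P")
      case True
      then have "\<chi> 2 (s + 1) = \<chi> 2 1" using s by (intro symbol_cong) (simp_all add: cg_def)
      then show ?thesis using True m by (simp add: symbol_P symbol_1)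
    next
      case False
      then show ?thesis using m symbol_2_cases[OF s False] by auto
    qed
    then show "(1 + \<chi> 2 (s ^ 2 + s)) * ((if s \<in> P then 1 else \<chi> 2 s) * H s) = \<chi> 2 s * H s + \<chi> 2 (s + 1) * H s"
      by (simp only: mult.assoc[symmetric] distrib_right)
  qed
  also have "\<dots> = (\<Sum>s\<in>R. \<chi> 2 s * H s) + (\<Sum>s\<in>R. \<chi> 2 (s + 1) * H s)" by (rule sum.distrib)
  also have "(\<Sum>s\<in>R. \<chi> 2 (s + 1) * H s) = (\<Sum>s\<in>R. \<chi> 2 (- 1 - s + 1) * H (- 1 - s))"
    by (rule sum_reindex_R[symmetric, where \<psi> = "\<lambda>s. - 1 - s"])
      (auto intro!: cg_diff arg_cong2[of _ _ _ _ "(*)"] symbol_cong cg_add H)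
  also have "\<dots> = (\<Sum>s\<in>R. \<chi> 2 s * H s)"
  proof (intro sum.cong refl)
    fix s assume "s \<in> R"
    then have "\<chi> 2 (- 1 - s + 1) = \<chi> 2 s" using symbol_2_minus R_subset_O8 by simp
    moreover have "H (- 1 - s) = H s" by (simp add: H_def power2_eq_square algebra_simps)
    ultimately show "\<chi> 2 (- 1 - s + 1) * H (- 1 - s) = \<chi> 2 s * H s" by simp
  qed
  finally show ?thesis by (simp add: H_def)
qed

lemma quartic_sum_eq_quadratic_sum:
  fixes F :: "complex \<Rightarrow> complex"
  assumes F: "\<And>x y. x \<approx> y \<Longrightarrow> F x = F y"
  shows "(\<Sum>x\<in>U. \<chi> 4 x * F (x + inv_mod p x - 2)) = (\<Sum>s\<in>R. \<chi> 2 s * F (16 * (s ^ 2 + s)))"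
proof -
  have "(\<Sum>y\<in>U. \<chi> 2 y * F (y ^ 2 + inv_mod p (y ^ 2) - 2)) = 2 * (\<Sum>x\<in>U. \<chi> 4 x * F (x + inv_mod p x - 2))"
  proof (rule quartic_sum)
    show "F (x + inv_mod p x - 2) = F (y + inv_mod p y - 2)" if "x \<approx> y" "x \<notin> P" for x y
      using that inv_mod_cong by (intro F cg_add cg_diff) simp_all
    fix x assume x: "x \<in> O8" "x \<notin> P"
    have "inv_mod p x + inv_mod p (inv_mod p x) - 2 \<approx> inv_mod p x + x - 2"
      using x inv_inv inv_O8 by (intro cg_diff cg_add) simp_all
    then show "F (inv_mod p x + inv_mod p (inv_mod p x) - 2) = F (x + inv_mod p x - 2)"
      using F by (simp add: add.commute)
  qed
  also have "(\<Sum>y\<in>U. \<chi> 2 y * F (y ^ 2 + inv_mod p (y ^ 2) - 2)) = 2 * (\<Sum>s\<in>R. \<chi> 2 s * F (16 * (s ^ 2 + s)))"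
    using F by (rule quadratic_twist_sum)
  finally have "2 * (\<Sum>x\<in>U. \<chi> 4 x * F (x + inv_mod p x - 2)) = 2 * (\<Sum>s\<in>R. \<chi> 2 s * F (16 * (s ^ 2 + s)))"
    by (rule sym)
  then show ?thesis by (subst (asm) mult_left_cancel) (rule zero_neq_numeral[symmetric])
qed

section \<open>The exponential sums\<close>

lemma irreducible_p: "irreducible ringO p"
  unfolding irreducible_def
proof (intro conjI ballI impI)
  show "p \<notin> Units ringO"
    using ring_prime_p by (simp add: ring_prime_def prime_def)
  fix b assume b: "b \<in> carrier ringO" and pf: "properfactor ringO b p"
  from pf obtain c where c: "c \<in> O8" "p = b * c" by (auto simp: properfactor_def divides_ringO)
  have "b \<notin> P"
    using pf by (auto simp: properfactor_def divides_ringO mem_PIdl_iff mult.commute)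
  moreover have "b * c \<in> P" using c(2) O.cgenideal_self[of p] p_O8 by simp
  ultimately have "c \<in> P" using P_prime[of b c] b c(1) by simp
  then obtain d where d: "d \<in> O8" "c = d * p" by (auto simp: mem_PIdl_iff)
  have "p * 1 = p * (b * d)" using c(2) unfolding d(2) by (simp add: mult_ac)
  then have "b * d = 1" using p_neq_0 by (metis mult_left_cancel)
  then show "b \<in> Units ringO" using b d(1) by (auto simp: Units_ringO)
qed

text \<open>
  As \<open>p\<close> is prime, it divides some factor \<open>q\<close>; cancelling \<open>p\<close> shows that the product of the other
  factors is a unit, and irreducible elements are not units.
\<close>

lemma wfactors_p:
  assumes qs: "set qs \<subseteq> O8" and wf: "wfactors ringO qs p"
  shows "\<exists>q. qs = [q] \<and> PIdl\<^bsub>ringO\<^esub> q = P"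
proof -
  have irr: "irreducible ringO q" if "q \<in> set qs" for q using wf that by (simp add: wfactors_def)
  have prod_O8: "prod_list xs \<in> O8" if "set xs \<subseteq> O8" for xs
    using that by (induction xs) auto
  have "prod_list qs = foldr (\<otimes>\<^bsub>ringO\<^esub>) qs \<one>\<^bsub>ringO\<^esub>" by (simp add: prod_list.eq_foldr)
  then have as: "prod_list qs \<sim>\<^bsub>ringO\<^esub> p" using wf by (simp add: wfactors_def)
  then obtain t where t: "t \<in> O8" "p = prod_list qs * t"
    by (auto simp: associated_def divides_ringO)
  from as obtain t' where t': "t' \<in> O8" "prod_list qs = p * t'"
    by (auto simp: associated_def divides_ringO)
  have "prod_list qs \<in> P" using t' by (auto simp: mem_PIdl_iff mult.commute)
  then have "\<exists>q\<in>set qs. q \<in> P" using qs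
  proof (induction qs)
    case Nil
    then show ?case using one_notin_P by simp
  next
    case (Cons q qs)
    then have "q \<in> P \<or> prod_list qs \<in> P" using P_prime[of q "prod_list qs"] prod_O8[of qs] by simp
    then show ?case using Cons by auto
  qed
  then obtain q where q: "q \<in> set qs" "q \<in> P" by blast
  then obtain w where w: "w \<in> O8" "q = w * p" by (auto simp: mem_PIdl_iff)
  obtain xs ys where split: "qs = xs @ q # ys" using q(1) by (auto simp: in_set_conv_decomp)
  have qO: "q \<in> O8" and xsO: "set xs \<subseteq> O8" and ysO: "set ys \<subseteq> O8" using qs split by auto
  have "p * 1 = p * (prod_list xs * w * prod_list ys * t)"
    using t(2) unfolding split by (simp add: w(2) mult_ac)
  then have one: "prod_list xs * w * prod_list ys * t = 1" using p_neq_0 by (metis mult_left_cancel)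
  have unit: False if "x \<in> set qs" "z \<in> O8" "x * z = 1" for x z
    using irr[OF that(1)] that qs by (auto simp: irreducible_def Units_ringO)
  have "xs = []"
  proof (cases xs)
    case (Cons x xs')
    have "x * (prod_list xs' * w * prod_list ys * t) = 1" using one Cons by (simp add: mult_ac)
    moreover have "prod_list xs' * w * prod_list ys * t \<in> O8"
      using prod_O8[of xs'] prod_O8[of ys] xsO ysO Cons w t by (intro O8_mult) auto
    ultimately show ?thesis using unit[of x] split Cons by auto
  qed
  moreover have "ys = []"
  proof (cases ys)
    case (Cons y ys')
    have "y * (prod_list xs * w * prod_list ys' * t) = 1" using one Cons by (simp add: mult_ac)
    moreover have "prod_list xs * w * prod_list ys' * t \<in> O8"
      using prod_O8[of ys'] prod_O8[of xs] xsO ysO Cons w t by (intro O8_mult) auto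
    ultimately show ?thesis using unit[of y] split Cons by auto
  qed
  ultimately have "qs = [q]" using split by simp
  moreover have "PIdl\<^bsub>ringO\<^esub> q = P"
  proof (intro subset_antisym subsetI)
    fix x assume "x \<in> PIdl\<^bsub>ringO\<^esub> q"
    then show "x \<in> P" using q(2) P_mult_left by (auto simp: mem_PIdl_iff)
  next
    fix x assume "x \<in> P"
    then obtain r where r: "r \<in> O8" "x = r * p" by (auto simp: mem_PIdl_iff)
    then have "x = (r * t) * q" using t(2) \<open>qs = [q]\<close> by (simp add: mult_ac)
    then show "x \<in> PIdl\<^bsub>ringO\<^esub> q" using r t unfolding mem_PIdl_iff by blast
  qed
  ultimately show ?thesis by blast
qed

text \<open>
  The factorisation of \<open>p\<close> chosen in \<open>residue_symbol\<close> consists of a single associate \<open>q\<close> of \<open>p\<close>, and the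
  symbol modulo \<open>q\<close> depends only on the ideal generated by \<open>q\<close>.
\<close>

lemma residue_symbol_eq: "residue_symbol n x p = \<chi> n x"
proof -
  have "wfactors ringO [p] p"
    using irreducible_p p_O8 by (simp add: wfactors_def O.associated_refl)
  then have "\<exists>qs. set qs \<subseteq> O8 \<and> wfactors ringO qs p" using p_O8 by (intro exI[of _ "[p]"]) simp
  from someI_ex[OF this]
  obtain q where "(SOME qs. set qs \<subseteq> O8 \<and> wfactors ringO qs p) = [q]" and q: "PIdl\<^bsub>ringO\<^esub> q = P"
    using wfactors_p by blast
  then have "residue_symbol n x p = prime_residue_symbol n x q" by (simp add: residue_symbol_def)
  also have "\<dots> = \<chi> n x" unfolding prime_residue_symbol_def abs_norm_def q ..
  finally show ?thesis .
qed

lemma add_char_mod: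
  assumes \<delta>: "different_generator \<delta>"
  shows add_char_cong: "x \<approx> y \<Longrightarrow> add_char \<delta> (x / p) = add_char \<delta> (y / p)"
    and add_char_mod_add: "x \<in> O8 \<Longrightarrow> y \<in> O8 \<Longrightarrow>
      add_char \<delta> ((x + y) / p) = add_char \<delta> (x / p) * add_char \<delta> (y / p)"
proof -
  show add: "add_char \<delta> ((x + y) / p) = add_char \<delta> (x / p) * add_char \<delta> (y / p)"
    if "x \<in> O8" "y \<in> O8" for x y
    unfolding add_divide_distrib
    using that p_O8 O8_subset_F8 by (intro add_char_add[OF \<delta>] F8_divide) auto
  show "add_char \<delta> (x / p) = add_char \<delta> (y / p)" if xy: "x \<approx> y"
  proof -
    have "x - y \<in> P" using xy by (simp add: cg_def)
    then obtain r where r: "r \<in> O8" "x - y = r * p" unfolding mem_PIdl_iff by blast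
    have "add_char \<delta> ((x - y + y) / p) = add_char \<delta> ((x - y) / p) * add_char \<delta> (y / p)"
      using xy by (intro add) (auto simp: cg_def)
    moreover have "add_char \<delta> ((x - y) / p) = 1"
      unfolding r(2) using p_neq_0 add_char_O8[OF \<delta> r(1)] by simp
    ultimately show ?thesis by simp
  qed
qed

lemma coprime_notin_P:
  assumes "x \<in> O8" "Idl\<^bsub>ringO\<^esub> {x, p} = O8"
  shows "x \<notin> P"
proof
  assume "x \<in> P"
  moreover have "p \<in> P" using O.cgenideal_self[of p] p_O8 by simp
  ultimately have "Idl\<^bsub>ringO\<^esub> {x, p} \<subseteq> P" by (intro O.genideal_minimal P.is_ideal) simp
  then show False using assms(2) one_notin_P by auto
qed

text \<open>
  Here \<open>a\<close> stands for \<open>B ^ 2 / (16 A)\<close>. Substituting \<open>x = B s / A\<close> turns \<open>A x ^ 2 + B x\<close> into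
  \<open>16 a (s ^ 2 + s)\<close>, and \<open>- (B ^ 2) / (8 A)\<close> is \<open>- 2 a\<close>, which supplies the \<open>- 2\<close> in \<open>x + 1 / x - 2\<close>.
\<close>

lemma twisted_quadratic_sum:
  assumes \<delta>: "different_generator \<delta>" and A: "A \<in> O8" "A \<notin> P" and B: "B \<in> O8" "B \<notin> P"
  shows "(\<Sum>x\<in>R. \<chi> 2 x * add_char \<delta> ((A * x ^ 2 + B * x) / p)) =
    \<chi> 2 (A * B) * add_char \<delta> (- (B ^ 2) * inv_mod p (8 * A) / p)
      * (\<Sum>x\<in>U. \<chi> 4 x * add_char \<delta> ((inv_mod p (4 ^ 2 * A) * B ^ 2 * x
          + inv_mod p (4 ^ 2 * A) * B ^ 2 * inv_mod p x) / p))"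
proof -
  define \<psi> where "\<psi> x = add_char \<delta> (x / p)" for x
  have \<psi>: "\<psi> x = \<psi> y" if "x \<approx> y" for x y using add_char_cong[OF \<delta> that] by (simp add: \<psi>_def)
  define a where "a = inv_mod p (4 ^ 2 * A) * B ^ 2"
  define A' where "A' = inv_mod p A"
  have A': "A' \<in> O8" "A * A' \<approx> 1" "A' \<notin> P" using inv_mod_props[OF A] by (simp_all add: A'_def)
  have n16: "4 ^ 2 * A \<in> O8" "4 ^ 2 * A \<notin> P"
    using A P_prime[of 16 A] P_prime[of 4 4] four_notin_P by simp_all
  have n8: "8 * A \<in> O8" "8 * A \<notin> P"
    using A P_prime[of 8 A] P_prime[of 4 2] four_notin_P two_notin_P by simp_all
  note i16 = inv_O8[OF n16] inv_cg[OF n16]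
  note i8 = inv_O8[OF n8] inv_cg[OF n8]
  have aO: "a \<in> O8" using i16 B by (simp add: a_def)
  have a16: "16 * a \<approx> B ^ 2 * A'"
  proof (rule cg_cancel[OF A])
    have "A * (16 * a) = (4 ^ 2 * A) * inv_mod p (4 ^ 2 * A) * B ^ 2" by (simp add: a_def mult_ac)
    also have "\<dots> \<approx> 1 * B ^ 2" using i16 B by (intro cg_mult) simp_all
    also have "1 * B ^ 2 = B ^ 2 * 1" by simp
    also have "\<dots> \<approx> B ^ 2 * (A * A')" using A' B by (intro cg_mult cg_sym[OF A'(2)]) simp_all
    also have "B ^ 2 * (A * A') = A * (B ^ 2 * A')" by simp
    finally show "A * (16 * a) \<approx> A * (B ^ 2 * A')" .
  qed (use aO B A' in simp_all)
  have a2: "- (B ^ 2) * inv_mod p (8 * A) \<approx> - 2 * a"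
  proof (rule cg_cancel[OF n8])
    have "8 * A * (- (B ^ 2) * inv_mod p (8 * A)) = - (B ^ 2) * (8 * A * inv_mod p (8 * A))" by simp
    also have "\<dots> \<approx> - (B ^ 2) * 1" using i8 B by (intro cg_mult) simp_all
    also have "\<dots> \<approx> - (B ^ 2) * (4 ^ 2 * A * inv_mod p (4 ^ 2 * A))"
      using B by (intro cg_mult cg_sym[OF i16(2)]) simp_all
    also have "- (B ^ 2) * (4 ^ 2 * A * inv_mod p (4 ^ 2 * A)) = 8 * A * (- 2 * a)"
      by (simp add: a_def)
    finally show "8 * A * (- (B ^ 2) * inv_mod p (8 * A)) \<approx> 8 * A * (- 2 * a)" .
  qed (use i8 aO B in simp_all)

  have "(\<Sum>x\<in>R. \<chi> 2 x * \<psi> (A * x ^ 2 + B * x)) =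
      (\<Sum>s\<in>R. \<chi> 2 (B * A' * s) * \<psi> (A * (B * A' * s) ^ 2 + B * (B * A' * s)))"
  proof (rule sum_reindex_R[symmetric, where \<psi> = "\<lambda>x. inv_mod p B * A * x"])
    note iB = inv_O8[OF B] inv_cg[OF B]
    fix x y assume xy: "x \<approx> y"
    show "\<chi> 2 x * \<psi> (A * x ^ 2 + B * x) = \<chi> 2 y * \<psi> (A * y ^ 2 + B * y)"
      using xy A B by (intro arg_cong2[of _ _ _ _ "(*)"] symbol_cong \<psi> cg_add cg_mult cg_power) simp_all
    show "B * A' * x \<approx> B * A' * y" using xy A' B by (intro cg_mult) simp_all
    show "inv_mod p B * A * x \<approx> inv_mod p B * A * y" using xy A iB by (intro cg_mult) simp_all
  next
    note iB = inv_O8[OF B] inv_cg[OF B]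
    fix x assume x: "x \<in> O8"
    have "(B * inv_mod p B) * (A * A') * x \<approx> 1 * 1 * x"
      using x A'(2) iB(2) by (intro cg_mult) simp_all
    then show "inv_mod p B * A * (B * A' * x) \<approx> x" "B * A' * (inv_mod p B * A * x) \<approx> x"
      by (simp_all add: mult_ac)
  qed
  also have "\<dots> = (\<Sum>s\<in>R. \<chi> 2 (A * B) * (\<chi> 2 s * \<psi> (a * (16 * (s ^ 2 + s)))))"
  proof (intro sum.cong refl)
    fix s assume "s \<in> R"
    then have s: "s \<in> O8" by (rule R_subset_O8)
    have "\<chi> 2 A * \<chi> 2 A' = 1" using symbol_inv[OF A, of 2] by (simp add: A'_def)
    then have "\<chi> 2 A' = \<chi> 2 A" using symbol_2_cases[OF A] by (auto simp: minus_equation_iff[of _ 1])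
    then have 1: "\<chi> 2 (B * A' * s) = \<chi> 2 (A * B) * \<chi> 2 s"
      using A B A' s by (simp add: symbol_mult)
    have "A * (B * A' * s) ^ 2 + B * (B * A' * s) = (B ^ 2 * A') * ((A * A') * s ^ 2 + s)"
      by (simp add: power2_eq_square algebra_simps)
    also have "\<dots> \<approx> (16 * a) * (1 * s ^ 2 + s)"
      using s A' by (intro cg_mult[OF cg_sym[OF a16]] cg_mult cg_add) simp_all
    also have "(16 * a) * (1 * s ^ 2 + s) = a * (16 * (s ^ 2 + s))" by simp
    finally show "\<chi> 2 (B * A' * s) * \<psi> (A * (B * A' * s) ^ 2 + B * (B * A' * s))
        = \<chi> 2 (A * B) * (\<chi> 2 s * \<psi> (a * (16 * (s ^ 2 + s))))"
      using \<psi> 1 by simp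
  qed
  also have "\<dots> = \<chi> 2 (A * B) * (\<Sum>s\<in>R. \<chi> 2 s * \<psi> (a * (16 * (s ^ 2 + s))))"
    by (rule sum_distrib_left[symmetric])
  also have "(\<Sum>s\<in>R. \<chi> 2 s * \<psi> (a * (16 * (s ^ 2 + s)))) = (\<Sum>x\<in>U. \<chi> 4 x * \<psi> (a * (x + inv_mod p x - 2)))"
    by (rule quartic_sum_eq_quadratic_sum[symmetric, where F = "\<lambda>z. \<psi> (a * z)"])
      (use aO in \<open>auto intro!: \<psi> cg_mult\<close>)
  also have "\<dots> = (\<Sum>x\<in>U. \<psi> (- (B ^ 2) * inv_mod p (8 * A)) * (\<chi> 4 x * \<psi> (a * x + a * inv_mod p x)))"
  proof (intro sum.cong refl)
    fix x assume "x \<in> U"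
    then have x: "x \<in> O8" "inv_mod p x \<in> O8" using U_O8 inv_O8 by auto
    have "a * (x + inv_mod p x - 2) = - 2 * a + (a * x + a * inv_mod p x)" by (simp add: algebra_simps)
    then have "\<psi> (a * (x + inv_mod p x - 2)) = \<psi> (- 2 * a) * \<psi> (a * x + a * inv_mod p x)"
      using add_char_mod_add[OF \<delta>, of "- 2 * a" "a * x + a * inv_mod p x"] x aO by (simp add: \<psi>_def)
    also have "\<psi> (- 2 * a) = \<psi> (- (B ^ 2) * inv_mod p (8 * A))" using \<psi>[OF a2] by (rule sym)
    finally show "\<chi> 4 x * \<psi> (a * (x + inv_mod p x - 2))
        = \<psi> (- (B ^ 2) * inv_mod p (8 * A)) * (\<chi> 4 x * \<psi> (a * x + a * inv_mod p x))"
      by (simp only: mult_ac)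
  qed
  also have "\<dots> = \<psi> (- (B ^ 2) * inv_mod p (8 * A)) * (\<Sum>x\<in>U. \<chi> 4 x * \<psi> (a * x + a * inv_mod p x))"
    by (rule sum_distrib_left[symmetric])
  finally show ?thesis unfolding \<psi>_def a_def mult.assoc[symmetric] .
qed

end

theorem theorem8p1:
  fixes \<delta> A B p :: complex
  assumes "different_generator \<delta>"
    and "A \<in> O8" and "B \<in> O8" and "p \<in> O8"
    and "ring_prime\<^bsub>ringO\<^esub> p"
    and "[abs_norm p = 1] (mod 4)"
    and "Idl\<^bsub>ringO\<^esub> {A * B, p} = O8"
  shows "residue_sum p (\<lambda>x. add_char \<delta> ((A * x ^ 4 + B * x ^ 2) / p))
           - residue_sum p (\<lambda>x. add_char \<delta> ((A * x ^ 2 + B * x) / p))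
         = residue_sum p (\<lambda>x. residue_symbol 2 x p * add_char \<delta> ((A * x ^ 2 + B * x) / p))
       \<and> residue_sum p (\<lambda>x. residue_symbol 2 x p * add_char \<delta> ((A * x ^ 2 + B * x) / p))
         = residue_symbol 2 (A * B) p
           * add_char \<delta> (- (B ^ 2) * inv_mod p (8 * A) / p)
           * kloosterman4 \<delta> (inv_mod p (4 ^ 2 * A) * B ^ 2) (inv_mod p (4 ^ 2 * A) * B ^ 2) p"
proof -
  interpret prime_modulus p
    using assms(4-6) by unfold_locales (simp_all add: cong_def)
  have "A * B \<notin> P" using assms(2,3,7) by (intro coprime_notin_P) simp_all
  then have AB: "A \<notin> P" "B \<notin> P" using P_mult_left P_mult_right assms(2,3) by blast+
  define F where "F u = add_char \<delta> ((A * u ^ 2 + B * u) / p)" for u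
  have "F x = F y" if "x \<approx> y" for x y
    unfolding F_def using that assms(2,3)
    by (intro add_char_cong assms(1) cg_add cg_mult cg_power) simp_all
  then have "(\<Sum>x\<in>R. F (x ^ 2)) = (\<Sum>u\<in>R. F u) + (\<Sum>u\<in>R. \<chi> 2 u * F u)" by (rule sum_squares)
  moreover have "F (x ^ 2) = add_char \<delta> ((A * x ^ 4 + B * x ^ 2) / p)" for x
    by (simp add: F_def flip: power_mult)
  ultimately show ?thesis
    unfolding residue_sum_eq kloosterman4_def unit_residue_sum_eq residue_symbol_eq
    using twisted_quadratic_sum[OF assms(1,2) AB(1) assms(3) AB(2)] by (simp add: F_def)
qed

end
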